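(* Let $G\le\mathrm{Aut}(T)$ be a weakly branch group and $\mathcal{H}$ a uniformly recurrent subgroup of $G$. Then: (i) the map $\mathcal{H}\to\mathcal{F}(\partial T)$, $H\mapsto\mathrm{Fix}(H)$, is continuous; (ii) there exists a continuous $G$-equivariant map $\sigma:F_{\mathcal{H}}\to\Pi(T)$ such that (a) $\pi_\perp\circ\sigma=\mathrm{id}$, and (b) for every $H\in\mathcal{H}$ and every $v\in\sigma(\mathrm{Fix}(H))$ one has $\mathrm{Rist}_G(v)'\le H$.
   Context: $T$ is a locally finite rooted tree, $\mathrm{Aut}(T)$ the root-fixing automorphisms, $\partial T$ the boundary; for a vertex $v$, $T_v$ is the subtree below $v$, $\partial T_v$ the corresponding clopen subset of $\partial T$, and $\mathrm{Rist}_G(v)$ the set of elements of $G$ acting trivially outside $T_v$; $K'$ is the derived subgroup. $G$ is weakly branch if $T$ is infinite and spherically homogeneous, $G$ acts transitively on each level, and $\mathrm{Rist}_G(v)\ne\{1\}$ for all $v$. $\mathrm{Sub}(G)$ is the space of subgroups with the Chabauty topology (product topology on $\{0,1\}^G$) and conjugation action; a uniformly recurrent subgroup is a closed minimal $G$-invariant subset of $\mathrm{Sub}(G)$. $\mathcal{F}(\partial T)$ is the space of closed subsets of $\partial T$ with the Hausdorff topology. For $H\le\mathrm{Aut}(T)$, $\mathrm{Fix}(H)\subset\partial T$ is its set of fixed points, and $F_{\mathcal{H}}=\{\mathrm{Fix}(H):H\in\mathcal{H}\}$. Two vertices $v,w$ are independent if $T_v\cap T_w=\varnothing$; $\Pi(T)$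 is the set of sets of pairwise independent vertices of $T$, with the topology induced from the product topology on the power set $\{0,1\}^{V(T)}$ of the vertex set. The map $\pi_\perp:\Pi(T)\to\mathcal{F}(\partial T)$ is $\pi_\perp(\mathcal{V})=\partial T\setminus\bigsqcup_{v\in\mathcal{V}}\partial T_v$. *)

theory Defs
  imports "HOL-Analysis.Analysis" "HOL-Library.Sublist"
begin

text \<open>A spherically homogeneous, locally finite rooted tree T is given by its branching
  sequence m: vertices of level n are the lists xs of length n with xs!i < m i.
  The root is the empty list; w lies in T_v iff v is a prefix of w.\<close>

type_synonym vert = "nat list"
type_synonym autom = "vert \<Rightarrow> vert"
type_synonym ray = "nat \<Rightarrow> nat"

definition verts :: "(nat \<Rightarrow> nat) \<Rightarrow> vert set" where
  "verts m = {xs. \<forall>i<length xs. xs ! i < m i}"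

definition is_aut :: "(nat \<Rightarrow> nat) \<Rightarrow> autom \<Rightarrow> bool" where
  "is_aut m g \<longleftrightarrow> bij_betw g (verts m) (verts m)
     \<and> (\<forall>x\<in>verts m. \<forall>y\<in>verts m. prefix x y \<longleftrightarrow> prefix (g x) (g y))
     \<and> (\<forall>x. x \<notin> verts m \<longrightarrow> g x = x)"

definition is_subgroup :: "autom set \<Rightarrow> bool" where
  "is_subgroup H \<longleftrightarrow> id \<in> H \<and> (\<forall>a\<in>H. \<forall>b\<in>H. a \<circ> b \<in> H) \<and> (\<forall>a\<in>H. inv a \<in> H)"

definition aut_group :: "(nat \<Rightarrow> nat) \<Rightarrow> autom set \<Rightarrow> bool" where
  "aut_group m G \<longleftrightarrow> G \<subseteq> {g. is_aut m g} \<and> is_subgroup G"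

definition subgroups_of :: "autom set \<Rightarrow> autom set set" where
  "subgroups_of G = {H. H \<subseteq> G \<and> is_subgroup H}"

text \<open>Chabauty topology on Sub(G): induced from the product topology on {0,1}^G.\<close>
definition chabauty :: "autom set \<Rightarrow> autom set topology" where
  "chabauty G = topology_generated_by
     ({{H \<in> subgroups_of G. g \<in> H} | g. g \<in> G} \<union> {{H \<in> subgroups_of G. g \<notin> H} | g. g \<in> G})"

definition conj :: "autom \<Rightarrow> autom set \<Rightarrow> autom set" where
  "conj g H = (\<lambda>h. g \<circ> h \<circ> inv g) ` H"

definition G_invariant_sub :: "autom set \<Rightarrow> autom set set \<Rightarrow> bool" where
  "G_invariant_sub G \<H> \<longleftrightarrow> (\<forall>g\<in>G. \<forall>H\<in>\<H>. conj g H \<in> \<H>)"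

definition is_URS :: "autom set \<Rightarrow> autom set set \<Rightarrow> bool" where
  "is_URS G \<H> \<longleftrightarrow> \<H> \<noteq> {} \<and> \<H> \<subseteq> subgroups_of G \<and> closedin (chabauty G) \<H>
     \<and> G_invariant_sub G \<H>
     \<and> (\<forall>\<K>. \<K> \<noteq> {} \<and> \<K> \<subseteq> \<H> \<and> closedin (chabauty G) \<K> \<and> G_invariant_sub G \<K> \<longrightarrow> \<K> = \<H>)"

definition rist :: "(nat \<Rightarrow> nat) \<Rightarrow> autom set \<Rightarrow> vert \<Rightarrow> autom set" where
  "rist m G v = {g \<in> G. \<forall>w\<in>verts m. \<not> prefix v w \<longrightarrow> g w = w}"

definition gen_subgroup :: "autom set \<Rightarrow> autom set" where
  "gen_subgroup S = \<Inter>{H. is_subgroup H \<and> S \<subseteq> H}"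

definition derived :: "autom set \<Rightarrow> autom set" where
  "derived K = gen_subgroup {a \<circ> b \<circ> inv a \<circ> inv b | a b. a \<in> K \<and> b \<in> K}"

text \<open>Weakly branch (T infinite iff all m i > 0; spherical homogeneity built in).\<close>
definition weakly_branch :: "(nat \<Rightarrow> nat) \<Rightarrow> autom set \<Rightarrow> bool" where
  "weakly_branch m G \<longleftrightarrow> aut_group m G \<and> (\<forall>i. m i > 0)
     \<and> (\<forall>x\<in>verts m. \<forall>y\<in>verts m. length x = length y \<longrightarrow> (\<exists>g\<in>G. g x = y))
     \<and> (\<forall>v\<in>verts m. rist m G v \<noteq> {id})"

definition bd :: "(nat \<Rightarrow> nat) \<Rightarrow> ray set" where
  "bd m = {\<xi>. \<forall>i. \<xi> i < m i}"

definition cyl :: "(nat \<Rightarrow> nat) \<Rightarrow> vert \<Rightarrow> ray set" where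
  "cyl m v = {\<xi> \<in> bd m. \<forall>i<length v. \<xi> i = v ! i}"

definition bd_top :: "(nat \<Rightarrow> nat) \<Rightarrow> ray topology" where
  "bd_top m = topology_generated_by {cyl m v | v. v \<in> verts m}"

definition act_bd :: "autom \<Rightarrow> ray \<Rightarrow> ray" where
  "act_bd g \<xi> = (\<lambda>n. g (map \<xi> [0..<Suc n]) ! n)"

text \<open>Standard ultrametric on the boundary and the Hausdorff distance on closed sets
  (the empty set being an isolated point).\<close>
definition bd_dist :: "ray \<Rightarrow> ray \<Rightarrow> real" where
  "bd_dist \<xi> \<eta> = (if \<xi> = \<eta> then 0 else (1/2) ^ (LEAST n. \<xi> n \<noteq> \<eta> n))"

definition hdist :: "ray set \<Rightarrow> ray set \<Rightarrow> real" where
  "hdist A B = (if A = {} \<and> B = {} then 0 else if A = {} \<or> B = {} then 2 else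
     max (SUP x\<in>A. INF y\<in>B. bd_dist x y) (SUP y\<in>B. INF x\<in>A. bd_dist x y))"

definition closed_sets :: "(nat \<Rightarrow> nat) \<Rightarrow> ray set set" where
  "closed_sets m = {F. closedin (bd_top m) F}"

definition hausdorff_top :: "(nat \<Rightarrow> nat) \<Rightarrow> ray set topology" where
  "hausdorff_top m = topology_generated_by
     {{B \<in> closed_sets m. hdist A B < e} | A e. A \<in> closed_sets m \<and> e > 0}"

definition Fix :: "(nat \<Rightarrow> nat) \<Rightarrow> autom set \<Rightarrow> ray set" where
  "Fix m H = {\<xi> \<in> bd m. \<forall>h\<in>H. act_bd h \<xi> = \<xi>}"

text \<open>Pi(T): sets of pairwise independent vertices, topology induced from {0,1}^V(T).\<close>
definition indep :: "vert \<Rightarrow> vert \<Rightarrow> bool" where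
  "indep v w \<longleftrightarrow> \<not> prefix v w \<and> \<not> prefix w v"

definition Pi_T :: "(nat \<Rightarrow> nat) \<Rightarrow> vert set set" where
  "Pi_T m = {P. P \<subseteq> verts m \<and> (\<forall>v\<in>P. \<forall>w\<in>P. v \<noteq> w \<longrightarrow> indep v w)}"

definition Pi_top :: "(nat \<Rightarrow> nat) \<Rightarrow> vert set topology" where
  "Pi_top m = topology_generated_by
     ({{P \<in> Pi_T m. v \<in> P} | v. v \<in> verts m} \<union> {{P \<in> Pi_T m. v \<notin> P} | v. v \<in> verts m})"

definition pi_perp :: "(nat \<Rightarrow> nat) \<Rightarrow> vert set \<Rightarrow> ray set" where
  "pi_perp m P = bd m - (\<Union>v\<in>P. cyl m v)"

end

theory Submission
  imports Defs
begin

text \<open>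
  Everything rests on one principle: if a finite set \<open>\<Phi> K\<close> is attached equivariantly to each \<open>K\<close> in
  a minimal system and each condition \<open>t \<in> \<Phi> K\<close> is open, then it is also closed, because minimality
  makes the cardinality of \<open>\<Phi> K\<close> constant. Applied to the vertices of a given level missed by the fixed
  point set it gives (i). Applied to the permutations of a level induced by elements conjugating a given
  finite subset of \<open>H\<close> into \<open>K\<close>, it gives recurrence: finitely many conjugates of a finite set
  \<open>S \<subseteq> H\<close>, by elements fixing level n, suffice to meet every conjugate of \<open>H\<close> by such elements.

  Let \<open>H\<close> move the ray \<open>\<xi>\<close>. If \<open>x \<in> H\<close> moves a prefix w of \<open>\<xi>\<close>, recurrence shows that for k in a
  finite-index subgroup of \<open>Rist(w)\<close> there is \<open>e \<in> Rist(x w)\<close> with \<open>k e \<in> H\<close>. As rigid stabilizers have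
  infinite orbits, \<open>H \<xi>\<close> is infinite, so \<open>x, y \<in> H\<close> can be chosen with w, x w, y w distinct; commutators
  then show that \<open>[M, M] \<subseteq> H\<close> for some finite-index \<open>M \<subseteq> Rist(w)\<close>. Finally take \<open>\<gamma>, \<delta>\<close> in the normal core
  of \<open>M\<close> and a longer prefix u with u, \<open>\<gamma>\<close> u, \<open>\<delta>\<close> u distinct: for \<open>a, b \<in> Rist(u)\<close> the elements
  \<open>[a, \<gamma>]\<close> and \<open>[b, \<delta>]\<close> lie in \<open>M\<close> and their commutator is \<open>[a, b]\<close>.

  By the same principle \<open>Rist(w)' \<subseteq> K\<close> is a clopen condition on \<open>K\<close>, so by compactness there are levels
  \<open>N n\<close> such that \<open>Rist(w)' \<subseteq> K\<close> for all w of level \<open>N n\<close> below a vertex of level n missed by \<open>Fix K\<close>.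
  The section consists of all w of level \<open>N n\<close> below some minimal missed vertex of level n.
\<close>

subsection \<open>Rays, levels and tree automorphisms\<close>

lemma bij_inv_comp: "bij g \<Longrightarrow> inv g \<circ> g = id" "bij g \<Longrightarrow> g \<circ> inv g = id"
  by (auto simp: bij_def surj_iff)

lemma bij_inv_cancel: "bij g \<Longrightarrow> inv g (g x) = x" "bij g \<Longrightarrow> g (inv g x) = x"
  by (auto simp: bij_def surj_f_inv_f)

definition lev :: "(nat \<Rightarrow> nat) \<Rightarrow> nat \<Rightarrow> vert set" where
  "lev m n = {v \<in> verts m. length v = n}"

definition pre :: "ray \<Rightarrow> nat \<Rightarrow> vert" where
  "pre \<xi> n = map \<xi> [0..<n]"

lemma length_pre [simp]: "length (pre \<xi> n) = n"
  by (simp add: pre_def)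

lemma nth_pre [simp]: "i < n \<Longrightarrow> pre \<xi> n ! i = \<xi> i"
  by (simp add: pre_def)

lemma take_pre: "k \<le> n \<Longrightarrow> take k (pre \<xi> n) = pre \<xi> k"
  by (simp add: pre_def take_map)

lemma pre_eq_iff: "pre \<xi> n = pre \<eta> n \<longleftrightarrow> (\<forall>i<n. \<xi> i = \<eta> i)"
  by (auto simp: list_eq_iff_nth_eq)

lemma pre_eq_mono: "pre \<xi> n = pre \<eta> n \<Longrightarrow> k \<le> n \<Longrightarrow> pre \<xi> k = pre \<eta> k"
  by (auto simp: pre_eq_iff)

lemma pre_prefix: "k \<le> n \<Longrightarrow> prefix (pre \<xi> k) (pre \<xi> n)"
  by (metis take_is_prefix take_pre)

lemma ray_eqI: "(\<And>n. pre \<xi> n = pre \<eta> n) \<Longrightarrow> \<xi> = \<eta>"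
  by (metis ext lessI nth_pre)

lemma prefix_take_iff: "prefix v w \<longleftrightarrow> length v \<le> length w \<and> take (length v) w = v"
  by (metis append_eq_conv_conj prefix_def prefix_length_le)

lemma prefix_verts: "prefix x y \<Longrightarrow> y \<in> verts m \<Longrightarrow> x \<in> verts m"
  by (auto simp: verts_def prefix_def nth_append) (metis add.commute trans_less_add2)

lemma pre_verts: "\<xi> \<in> bd m \<Longrightarrow> pre \<xi> n \<in> verts m"
  by (auto simp: bd_def verts_def)

lemma pre_lev: "\<xi> \<in> bd m \<Longrightarrow> pre \<xi> n \<in> lev m n"
  by (auto simp: lev_def pre_verts)

lemma cyl_iff: "\<xi> \<in> cyl m v \<longleftrightarrow> \<xi> \<in> bd m \<and> pre \<xi> (length v) = v"
  by (auto simp: cyl_def list_eq_iff_nth_eq)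

lemma lev_snoc: "v \<in> lev m (Suc n) \<longleftrightarrow> (\<exists>u i. u \<in> lev m n \<and> i < m n \<and> v = u @ [i])"
proof
  assume v: "v \<in> lev m (Suc n)"
  then have "v \<noteq> []" by (auto simp: lev_def)
  then have "v = butlast v @ [last v]" by simp
  moreover have "last v < m n"
    using v \<open>v \<noteq> []\<close> by (auto simp: lev_def verts_def last_conv_nth)
  moreover have "butlast v \<in> lev m n"
    using v by (auto simp: lev_def intro: prefix_verts[OF prefixeq_butlast])
  ultimately show "\<exists>u i. u \<in> lev m n \<and> i < m n \<and> v = u @ [i]" by blast
next
  show "\<exists>u i. u \<in> lev m n \<and> i < m n \<and> v = u @ [i] \<Longrightarrow> v \<in> lev m (Suc n)"
    by (auto simp: lev_def verts_def nth_append less_Suc_eq)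
qed

lemma finite_lev: "finite (lev m n)"
proof (induction n)
  case 0
  have "lev m 0 \<subseteq> {[]}" by (auto simp: lev_def)
  then show ?case by (rule finite_subset) simp
next
  case (Suc n)
  have "lev m (Suc n) \<subseteq> (\<lambda>(u, i). u @ [i]) ` (lev m n \<times> {..<m n})"
    by (auto simp: lev_snoc)
  with Suc show ?case by (meson finite_SigmaI finite_imageI finite_lessThan finite_subset)
qed

lemma indep_same_length: "length u = length v \<Longrightarrow> u \<noteq> v \<Longrightarrow> indep u v"
  by (auto simp: indep_def prefix_take_iff)

lemma indep_extend: "indep u v \<Longrightarrow> prefix u u' \<Longrightarrow> prefix v v' \<Longrightarrow> indep u' v'"
  unfolding indep_def by (metis prefix_order.trans prefix_same_cases)

lemma indep_sym: "indep u v \<Longrightarrow> indep v u"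
  by (auto simp: indep_def)

text \<open>Compactness of the boundary in combinatorial form: by finite branching, a vertex with
  \<open>P\<close>-descendants on all deeper levels has a child of the same kind, and iteration
  yields the ray.\<close>

lemma koenig:
  assumes v: "v \<in> verts m"
    and down: "\<And>x y. P y \<Longrightarrow> prefix v x \<Longrightarrow> prefix x y \<Longrightarrow> P x"
    and inf: "\<And>N. N \<ge> length v \<Longrightarrow> \<exists>w\<in>lev m N. prefix v w \<and> P w"
  shows "\<exists>\<xi>\<in>cyl m v. \<forall>k\<ge>length v. P (pre \<xi> k)"
proof -
  define Q where "Q x \<longleftrightarrow> x \<in> verts m \<and> prefix v x \<and> (\<forall>N\<ge>length x. \<exists>w\<in>lev m N. prefix x w \<and> P w)" for x
  have Qv: "Q v" using v inf by (auto simp: Q_def)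
  have step: "\<exists>i. Q (x @ [i])" if "Q x" for x
  proof (rule ccontr)
    assume no: "\<nexists>i. Q (x @ [i])"
    let ?n = "length x"
    have "\<exists>N\<ge>Suc ?n. \<forall>w\<in>lev m N. prefix (x @ [i]) w \<longrightarrow> \<not> P w" if "i < m ?n" for i
    proof -
      have "x @ [i] \<in> verts m" 
        using \<open>Q x\<close> that lev_snoc[of "x @ [i]" m ?n] by (auto simp: Q_def lev_def)
      with no \<open>Q x\<close> show ?thesis by (auto simp: Q_def)
    qed
    then obtain f where f: "\<And>i. i < m ?n \<Longrightarrow> f i \<ge> Suc ?n \<and> (\<forall>w\<in>lev m (f i). prefix (x @ [i]) w \<longrightarrow> \<not> P w)"
      by metis
    \<comment> \<open>A level beyond all those at which the finitely many children fail. The summand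
      \<open>Suc ?n\<close> ensures that \<open>w\<close> has an entry at index \<open>?n\<close>
      and so passes through one of these children, which by \<open>down\<close> cannot have
      failed.\<close>
    define N where "N = Suc ?n + (\<Sum>i<m ?n. f i)"
    have fN: "f i \<le> N" if "i < m ?n" for i
      unfolding N_def using that by (intro trans_le_add2 member_le_sum) auto
    obtain w where w: "w \<in> lev m N" "prefix x w" "P w"
      using \<open>Q x\<close> unfolding Q_def N_def by (meson le_add1 le_SucI Suc_leD)
    have lw: "length w = N" using w by (simp add: lev_def)
    define i where "i = w ! ?n"
    have i: "i < m ?n" using w(1) by (auto simp: i_def lev_def verts_def N_def)
    have "prefix (x @ [i]) (take (f i) w)"
    proof -
      have "take (Suc ?n) w = x @ [i]"
        using w(2) lw by (auto simp: i_def prefix_take_iff take_Suc_conv_app_nth N_def)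
      then show ?thesis using f[OF i] fN[OF i] lw
        by (auto simp: prefix_take_iff min_def)
    qed
    moreover have "take (f i) w \<in> lev m (f i)"
      using w(1) fN[OF i] by (auto simp: lev_def intro: prefix_verts[OF take_is_prefix])
    moreover have "P (take (f i) w)"
    proof (rule down[OF w(3) _ take_is_prefix])
      show "prefix v (take (f i) w)"
        using \<open>Q x\<close> \<open>prefix (x @ [i]) (take (f i) w)\<close>
        by (meson Q_def append_prefixD prefix_order.trans)
    qed
    ultimately show False using f[OF i] by blast
  qed
  then obtain s where s: "\<And>x. Q x \<Longrightarrow> Q (x @ [s x])" by metis
  define r where "r k = ((\<lambda>x. x @ [s x]) ^^ k) v" for k
  have r: "Q (r k)" "length (r k) = length v + k" for k
    by (induction k) (use Qv s in \<open>auto simp: r_def\<close>)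
  have rS: "r (Suc k) = r k @ [s (r k)]" for k by (simp add: r_def)
  have rpre: "prefix (r j) (r k)" if "j \<le> k" for j k
    using that by (induction rule: dec_induct) (auto simp: rS)
  \<comment> \<open>Entry \<open>i\<close> is already final in \<open>r (Suc i)\<close>, whose
    length exceeds \<open>i\<close> whatever the length of \<open>v\<close>.\<close>
  define \<xi> where "\<xi> i = r (Suc i) ! i" for i
  have pr: "pre \<xi> (length v + k) = r k" for k
  proof (rule nth_equalityI)
    fix i assume "i < length (pre \<xi> (length v + k))"
    then have i: "i < length v + k" by simp
    have "r (Suc i) ! i = r k ! i"
      using rpre[of "Suc i" k] rpre[of k "Suc i"] r(2)[of k] r(2)[of "Suc i"] i
      by (cases "Suc i \<le> k") (auto simp: prefix_def nth_append)
    then show "pre \<xi> (length v + k) ! i = r k ! i" using i by (simp add: \<xi>_def)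
  qed (simp add: r)
  have "\<xi> i < m i" for i
    using r(1)[of "Suc i"] r(2)[of "Suc i"] by (auto simp: \<xi>_def Q_def verts_def)
  then have "\<xi> \<in> cyl m v"
    using pr[of 0] by (auto simp: cyl_iff bd_def r_def)
  moreover have "P (pre \<xi> k)" if "k \<ge> length v" for k
  proof -
    have "P (r (k - length v))"
    proof -
      obtain w where "w \<in> lev m (length (r (k - length v)))" "prefix (r (k - length v)) w" "P w"
        using r(1)[of "k - length v"] by (auto simp: Q_def)
      then show ?thesis by (auto simp: lev_def prefix_take_iff)
    qed
    with pr[of "k - length v"] that show ?thesis by simp
  qed
  ultimately show ?thesis by blast
qed

section \<open>Tree automorphisms and their action on rays\<close>

lemma aut_bij: assumes "is_aut m g" shows "bij g"
proof -
  \<comment> \<open>Off the tree \<open>g\<close> is the identity, so bijectivity extends to the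
    whole type and \<open>inv\<close> is the genuine group inverse.\<close>
  have "bij_betw g (- verts m) (- verts m)"
    using assms by (auto simp: is_aut_def intro!: bij_betwI[where g="\<lambda>x. x"])
  moreover have "bij_betw g (verts m) (verts m)" using assms by (simp add: is_aut_def)
  ultimately show ?thesis using bij_betw_combine[of g "verts m" "verts m" "- verts m" "- verts m"]
    by (simp add: Compl_partition)
qed

lemma aut_verts_iff: "is_aut m g \<Longrightarrow> g x \<in> verts m \<longleftrightarrow> x \<in> verts m"
  unfolding is_aut_def bij_betw_def by (metis imageI)

lemma aut_prefix: "is_aut m g \<Longrightarrow> prefix x y \<Longrightarrow> y \<in> verts m \<Longrightarrow> prefix (g x) (g y)"
  unfolding is_aut_def using prefix_verts by blast

lemma aut_prefix_iff: "is_aut m g \<Longrightarrow> x \<in> verts m \<Longrightarrow> y \<in> verts m \<Longrightarrow> prefix (g x) (g y) \<longleftrightarrow> prefix x y"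
  unfolding is_aut_def by blast

lemma aut_outside: "is_aut m g \<Longrightarrow> x \<notin> verts m \<Longrightarrow> g x = x"
  unfolding is_aut_def by blast

text \<open>The level of a vertex is visible in the prefix order: it is one less than the number of
  prefixes, and \<open>g\<close> maps the prefixes of \<open>x\<close> bijectively to those of
  \<open>g x\<close>.\<close>

lemma aut_length: assumes g: "is_aut m g" shows "length (g x) = length x"
proof (cases "x \<in> verts m")
  case True
  have c: "card {y. prefix y z} = Suc (length z)" for z :: vert
    by (metis card_set_prefixes set_prefixes_eq)
  have "{y. prefix y (g x)} = g ` {y. prefix y x}"
  proof (intro equalityI subsetI)
    fix y assume "y \<in> {y. prefix y (g x)}"
    then have y: "prefix y (g x)" by simp
    then have "y \<in> verts m" using True g by (auto simp: aut_verts_iff intro: prefix_verts)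
    then obtain z where z: "z \<in> verts m" "y = g z"
      using g unfolding is_aut_def bij_betw_def by (metis imageE)
    with y True g show "y \<in> g ` {y. prefix y x}" by (auto simp: aut_prefix_iff)
  qed (use g True in \<open>auto intro: aut_prefix\<close>)
  moreover have "inj g" using aut_bij[OF g] by (simp add: bij_def)
  ultimately have "card {y. prefix y (g x)} = card {y. prefix y x}"
    by (simp add: card_image inj_on_subset)
  then show ?thesis by (simp add: c)
qed (use g in \<open>simp add: aut_outside\<close>)

lemma aut_take:
  assumes g: "is_aut m g" and x: "x \<in> verts m"
  shows "g (take n x) = take n (g x)"
proof -
  have "prefix (g (take n x)) (g x)" by (rule aut_prefix[OF g take_is_prefix x])
  then show ?thesis using g by (simp add: prefix_take_iff aut_length min_def split: if_splits)
qed

lemma aut_lev: "is_aut m g \<Longrightarrow> g x \<in> lev m n \<longleftrightarrow> x \<in> lev m n"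
  by (simp add: lev_def aut_verts_iff aut_length)

text \<open>\<open>act_bd\<close> takes entry \<open>i\<close> from the image of the prefix of
  length \<open>i + 1\<close>; these entries are coherent because automorphisms commute with
  truncation.\<close>

lemma pre_act: assumes g: "is_aut m g" and xi: "\<xi> \<in> bd m"
  shows "pre (act_bd g \<xi>) n = g (pre \<xi> n)"
proof (rule nth_equalityI)
  fix i assume "i < length (pre (act_bd g \<xi>) n)"
  then have i: "i < n" by simp
  have "act_bd g \<xi> i = g (pre \<xi> (Suc i)) ! i" by (simp add: act_bd_def pre_def)
  also have "pre \<xi> (Suc i) = take (Suc i) (pre \<xi> n)" using i by (simp add: take_pre)
  also have "g \<dots> ! i = g (pre \<xi> n) ! i" by (simp add: aut_take[OF g pre_verts[OF xi]])
  finally show "pre (act_bd g \<xi>) n ! i = g (pre \<xi> n) ! i" using i by simp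
qed (simp add: aut_length[OF g])

lemma bd_iff_pre: "\<xi> \<in> bd m \<longleftrightarrow> (\<forall>n. pre \<xi> n \<in> verts m)"
proof
  show "\<xi> \<in> bd m \<Longrightarrow> \<forall>n. pre \<xi> n \<in> verts m" by (simp add: pre_verts)
  assume "\<forall>n. pre \<xi> n \<in> verts m"
  then have "\<forall>j<Suc i. pre \<xi> (Suc i) ! j < m j" for i by (simp add: verts_def)
  then have "\<xi> i < m i" for i by (metis lessI nth_pre)
  then show "\<xi> \<in> bd m" by (simp add: bd_def)
qed

lemma act_bd_in: "is_aut m g \<Longrightarrow> \<xi> \<in> bd m \<Longrightarrow> act_bd g \<xi> \<in> bd m"
  by (simp add: bd_iff_pre[of "act_bd g \<xi>"] pre_act aut_verts_iff pre_verts)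

lemma act_bd_comp: "is_aut m g \<Longrightarrow> is_aut m h \<Longrightarrow> is_aut m (g \<circ> h) \<Longrightarrow> \<xi> \<in> bd m \<Longrightarrow> act_bd (g \<circ> h) \<xi> = act_bd g (act_bd h \<xi>)"
  by (rule ray_eqI) (simp add: pre_act act_bd_in)

lemma act_bd_id [simp]: "act_bd id \<xi> = \<xi>"
  by (rule ext) (simp add: act_bd_def del: upt_Suc)

lemma act_eq_iff: "is_aut m g \<Longrightarrow> is_aut m h \<Longrightarrow> \<xi> \<in> bd m \<Longrightarrow> act_bd g \<xi> = act_bd h \<xi> \<longleftrightarrow> (\<forall>n. g (pre \<xi> n) = h (pre \<xi> n))"
  by (metis pre_act ray_eqI)

lemma is_aut_id: "is_aut m id"
  by (simp add: is_aut_def)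

text \<open>Trades the action on rays for conditions on vertices, each of which concerns only
  finitely many letters.\<close>

lemma Fix_iff:
  assumes "H \<subseteq> {g. is_aut m g}"
  shows "\<xi> \<in> Fix m H \<longleftrightarrow> \<xi> \<in> bd m \<and> (\<forall>h\<in>H. \<forall>n. h (pre \<xi> n) = pre \<xi> n)"
proof -
  have "act_bd h \<xi> = \<xi> \<longleftrightarrow> (\<forall>n. h (pre \<xi> n) = pre \<xi> n)" if "h \<in> H" "\<xi> \<in> bd m" for h
    using act_eq_iff[of m h id \<xi>] is_aut_id assms that by auto
  then show ?thesis unfolding Fix_def by blast
qed

subsection \<open>Finite-index subgroups\<close>

lemmas autom_group_simps = fun_eq_iff o_inv_distrib inv_inv_eq bij_inv_cancel bij_comp bij_imp_bij_inv

text \<open>In the expanded commutator \<open>c\<close> passes \<open>b\<close> and \<open>d\<close>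
  and meets its inverse; then \<open>d\<close> passes \<open>inv a\<close> and cancels too.\<close>

lemma commutator_perturb:
  assumes "bij a" "bij b" "bij c" "bij d"
    and cb: "c \<circ> b = b \<circ> c" and cd: "c \<circ> d = d \<circ> c" and da: "d \<circ> a = a \<circ> d"
  shows "(a \<circ> c) \<circ> (b \<circ> d) \<circ> inv (a \<circ> c) \<circ> inv (b \<circ> d) = a \<circ> b \<circ> inv a \<circ> inv b"
proof -
  have da': "d (inv a x) = inv a (d x)" for x
    using da assms(1) by (metis bij_inv_cancel comp_apply)
  show ?thesis
    using assms(1-4) cb cd da' by (simp add: autom_group_simps)
qed

text \<open>Finitely many left translates \<open>f M\<close> cover \<open>R\<close>. Phrased without
  cosets, this makes sense for any set \<open>M\<close> of maps.\<close>

definition finidx :: "autom set \<Rightarrow> autom set \<Rightarrow> bool" where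
  "finidx R M \<longleftrightarrow> (\<exists>F. finite F \<and> F \<subseteq> R \<and> (\<forall>\<gamma>\<in>R. \<exists>f\<in>F. inv f \<circ> \<gamma> \<in> M))"

text \<open>Choose one representative per colour: each element lies in the left translate of
  \<open>M\<close> by the representative of its colour.\<close>

lemma finidx_coloring:
  assumes "finite C" "\<And>\<gamma>. \<gamma> \<in> R \<Longrightarrow> c \<gamma> \<in> C"
    and same: "\<And>\<gamma> \<delta>. \<gamma> \<in> R \<Longrightarrow> \<delta> \<in> R \<Longrightarrow> c \<gamma> = c \<delta> \<Longrightarrow> inv \<gamma> \<circ> \<delta> \<in> M"
  shows "finidx R M"
  unfolding finidx_def
proof (intro exI conjI ballI)
  let ?s = "inv_into R c"
  show "finite (?s ` c ` R)" using assms(1,2) by (meson finite_imageI finite_subset image_subsetI)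
  show "?s ` c ` R \<subseteq> R" by (auto intro: inv_into_into)
  show "\<exists>f\<in>?s ` c ` R. inv f \<circ> \<gamma> \<in> M" if "\<gamma> \<in> R" for \<gamma>
    using that same[of "?s (c \<gamma>)" \<gamma>] by (auto simp: inv_into_into f_inv_into_f)
qed

text \<open>For a group \<open>R\<close> of bijections and \<open>M \<subseteq> R\<close>, the
  normal core: the intersection of all \<open>R\<close>-conjugates of \<open>M\<close>.\<close>

definition core :: "autom set \<Rightarrow> autom set \<Rightarrow> autom set" where
  "core R M = {b \<in> R. \<forall>\<gamma>\<in>R. inv \<gamma> \<circ> b \<circ> \<gamma> \<in> M}"

lemma is_subgroupD:
  assumes "is_subgroup H"
  shows "id \<in> H" "a \<in> H \<Longrightarrow> b \<in> H \<Longrightarrow> a \<circ> b \<in> H" "a \<in> H \<Longrightarrow> inv a \<in> H"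
  using assms by (auto simp: is_subgroup_def)

lemma core_subgroup:
  assumes R: "is_subgroup R" and M: "is_subgroup M" and bij: "\<And>g. g \<in> R \<Longrightarrow> bij g"
  shows "is_subgroup (core R M)"
  unfolding is_subgroup_def
proof (intro conjI ballI)
  show "id \<in> core R M"
    using is_subgroupD[OF R] is_subgroupD[OF M] bij by (auto simp: core_def bij_inv_comp)
  fix a assume a: "a \<in> core R M"
  {
    fix b assume b: "b \<in> core R M"
    have "inv \<gamma> \<circ> (a \<circ> b) \<circ> \<gamma> = (inv \<gamma> \<circ> a \<circ> \<gamma>) \<circ> (inv \<gamma> \<circ> b \<circ> \<gamma>)" if "\<gamma> \<in> R" for \<gamma>
      using bij[OF that] by (simp add: autom_group_simps)
    with a b show "a \<circ> b \<in> core R M"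
      using is_subgroupD(2)[OF R] is_subgroupD(2)[OF M] by (simp add: core_def)
  }
  have "inv \<gamma> \<circ> inv a \<circ> \<gamma> = inv (inv \<gamma> \<circ> a \<circ> \<gamma>)" if "\<gamma> \<in> R" for \<gamma>
    using bij[OF that] bij[of a] a by (simp add: core_def autom_group_simps)
  with a show "inv a \<in> core R M"
    using is_subgroupD(3)[OF R] is_subgroupD(3)[OF M] by (simp add: core_def)
qed

text \<open>\<open>R\<close> permutes the finitely many left cosets of \<open>M\<close>, and the
  core is the kernel of this action. The colour of \<open>\<beta>\<close> records where it sends the
  coset of each \<open>f \<in> F\<close>.\<close>

lemma core_finidx:
  assumes R: "is_subgroup R" and M: "is_subgroup M" and bij: "\<And>g. g \<in> R \<Longrightarrow> bij g"
    and MR: "M \<subseteq> R" and fin: "finidx R M"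
  shows "finidx R (core R M)"
proof -
  obtain F where F: "finite F" "F \<subseteq> R" "\<And>\<gamma>. \<gamma> \<in> R \<Longrightarrow> \<exists>f\<in>F. inv f \<circ> \<gamma> \<in> M"
    using fin by (auto simp: finidx_def)
  then obtain r where r: "\<And>\<gamma>. \<gamma> \<in> R \<Longrightarrow> r \<gamma> \<in> F" "\<And>\<gamma>. \<gamma> \<in> R \<Longrightarrow> inv (r \<gamma>) \<circ> \<gamma> \<in> M"
    by metis
  note Rs = is_subgroupD[OF R] and Ms = is_subgroupD[OF M]
  define c where "c \<beta> = restrict (\<lambda>f. r (\<beta> \<circ> f)) F" for \<beta>
  show ?thesis
  proof (rule finidx_coloring)
    show "finite (F \<rightarrow>\<^sub>E F)" using F(1) by (simp add: finite_PiE)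
    show "c \<gamma> \<in> F \<rightarrow>\<^sub>E F" if "\<gamma> \<in> R" for \<gamma>
      using that F(2) Rs(2) r(1) by (auto simp: c_def)
    fix \<beta> \<delta> assume bd: "\<beta> \<in> R" "\<delta> \<in> R" "c \<beta> = c \<delta>"
    have "inv \<gamma> \<circ> (inv \<beta> \<circ> \<delta>) \<circ> \<gamma> \<in> M" if g: "\<gamma> \<in> R" for \<gamma>
    proof -
      let ?f = "r \<gamma>" and ?f' = "r (\<beta> \<circ> r \<gamma>)"
      have f: "?f \<in> F" "?f \<in> R" using r(1)[OF g] F(2) by auto
      have e: "r (\<delta> \<circ> ?f) = ?f'" using bd(3) f(1) by (auto simp: c_def dest: fun_cong[where x="?f"])
      have f': "?f' \<in> R" using r(1) F(2) Rs(2)[OF bd(1) f(2)] by blast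
      have m: "inv ?f \<circ> \<gamma> \<in> M" "inv ?f' \<circ> (\<beta> \<circ> ?f) \<in> M" "inv ?f' \<circ> (\<delta> \<circ> ?f) \<in> M"
        using r(2)[OF g] r(2)[OF Rs(2)[OF bd(1) f(2)]] r(2)[OF Rs(2)[OF bd(2) f(2)]] e by auto
      \<comment> \<open>Equal colours put \<open>\<beta> f\<close> and \<open>\<delta> f\<close> in
        the same coset \<open>f' M\<close>, so the middle factor, which is
        \<open>inv \<beta> \<circ> \<delta>\<close> conjugated by \<open>f\<close>, is in
        \<open>M\<close>. The outer factors are in \<open>M\<close> and turn conjugation by
        \<open>f\<close> into conjugation by \<open>\<gamma>\<close>.\<close>
      have "inv (inv ?f \<circ> \<gamma>) \<circ> (inv (inv ?f' \<circ> (\<beta> \<circ> ?f)) \<circ> (inv ?f' \<circ> (\<delta> \<circ> ?f))) \<circ> (inv ?f \<circ> \<gamma>) \<in> M"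
        by (intro Ms m)
      also have "inv (inv ?f \<circ> \<gamma>) \<circ> (inv (inv ?f' \<circ> (\<beta> \<circ> ?f)) \<circ> (inv ?f' \<circ> (\<delta> \<circ> ?f))) \<circ> (inv ?f \<circ> \<gamma>)
          = inv \<gamma> \<circ> (inv \<beta> \<circ> \<delta>) \<circ> \<gamma>"
        using bij[OF g] bij[OF bd(1)] bij[OF bd(2)] bij[OF f(2)] bij[OF f'] by (simp add: autom_group_simps)
      finally show ?thesis .
    qed
    then show "inv \<beta> \<circ> \<delta> \<in> core R M" using bd Rs by (simp add: core_def)
  qed
qed

subsection \<open>Rigid stabilizers of a recurrent subgroup\<close>

locale weakly_branch_group =
  fixes m :: "nat \<Rightarrow> nat" and G :: "autom set"
  assumes wb: "weakly_branch m G"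
begin

lemma G_aut: "g \<in> G \<Longrightarrow> is_aut m g"
  and G_subgroup: "is_subgroup G"
  and transitive: "x \<in> lev m n \<Longrightarrow> y \<in> lev m n \<Longrightarrow> \<exists>g\<in>G. g x = y"
  and rist_nontriv: "v \<in> verts m \<Longrightarrow> rist m G v \<noteq> {id}"
  using wb unfolding weakly_branch_def aut_group_def lev_def by auto

lemma G_bij: "g \<in> G \<Longrightarrow> bij g"
  using G_aut aut_bij by blast

lemmas G_closed = is_subgroupD[OF G_subgroup]

lemma rist_G: "a \<in> rist m G u \<Longrightarrow> a \<in> G"
  by (simp add: rist_def)

lemma rist_fix: "a \<in> rist m G u \<Longrightarrow> \<not> prefix u z \<Longrightarrow> a z = z"
  by (cases "z \<in> verts m") (auto simp: rist_def aut_outside[OF G_aut])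

text \<open>\<open>a u\<close> has the length of \<open>u\<close>; if different from
  \<open>u\<close>, it lies outside the subtree below \<open>u\<close> and is fixed by
  \<open>a\<close>, which contradicts injectivity.\<close>

lemma rist_self: assumes a: "a \<in> rist m G u" shows "a u = u"
proof (rule ccontr)
  assume ne: "a u \<noteq> u"
  have "length (a u) = length u" using aut_length[OF G_aut[OF rist_G[OF a]]] .
  then have "\<not> prefix u (a u)" using ne by (auto simp: prefix_take_iff)
  then have "a (a u) = a u" using rist_fix[OF a] by blast
  then show False using ne G_bij[OF rist_G[OF a]] by (metis bij_inv_cancel(1))
qed

lemma rist_low: "a \<in> rist m G u \<Longrightarrow> length z \<le> length u \<Longrightarrow> a z = z"
  by (metis prefix_length_le prefix_take_iff le_antisym rist_fix rist_self take_all)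

lemma rist_prefix: assumes a: "a \<in> rist m G u" and z: "prefix u z" shows "prefix u (a z)"
proof (cases "z \<in> verts m")
  case True
  then show ?thesis using aut_prefix[OF G_aut[OF rist_G[OF a]] z] rist_self[OF a] by simp
next
  case False
  then show ?thesis using aut_outside[OF G_aut[OF rist_G[OF a]]] z by simp
qed

text \<open>The supports lie in disjoint subtrees, each preserved by its own element.\<close>

lemma rist_commute:
  assumes a: "a \<in> rist m G u" and b: "b \<in> rist m G v" and i: "indep u v"
  shows "a \<circ> b = b \<circ> a"
proof
  fix z
  have ex: "\<not> (prefix u x \<and> prefix v x)" for x
    using i prefix_same_cases unfolding indep_def by blast
  show "(a \<circ> b) z = (b \<circ> a) z"
  proof (cases "prefix u z")
    case True
    then show ?thesis
      using ex[of z] ex[of "a z"] rist_prefix[OF a True] rist_fix[OF b] by simp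
  next
    case False
    then show ?thesis
      using ex[of "b z"] rist_prefix[OF b, of z] rist_fix[OF b, of z] rist_fix[OF a, of z] rist_fix[OF a, of "b z"]
      by (cases "prefix v z") auto
  qed
qed

lemma rist_subgroup: "is_subgroup (rist m G u)"
  unfolding is_subgroup_def
proof (intro conjI ballI)
  show "id \<in> rist m G u" using G_closed by (simp add: rist_def)
  fix a assume a: "a \<in> rist m G u"
  show "a \<circ> b \<in> rist m G u" if "b \<in> rist m G u" for b
    using a that G_closed by (auto simp: rist_def)
  have "inv a w = w" if "a w = w" for w
    using that G_bij[OF rist_G[OF a]] by (metis bij_inv_cancel(1))
  then show "inv a \<in> rist m G u" using a G_closed by (auto simp: rist_def)
qed

lemmas rist_closed = is_subgroupD[OF rist_subgroup]

lemma rist_mono: "prefix u w \<Longrightarrow> rist m G w \<subseteq> rist m G u"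
  unfolding rist_def by (auto dest: prefix_order.trans)

lemma rist_conj:
  assumes g: "g \<in> G" and a: "a \<in> rist m G u" and u: "u \<in> verts m"
  shows "g \<circ> a \<circ> inv g \<in> rist m G (g u)"
  unfolding rist_def
proof (intro CollectI conjI ballI impI)
  show "g \<circ> a \<circ> inv g \<in> G" using g a G_closed rist_G by simp
  fix w assume w: "w \<in> verts m" "\<not> prefix (g u) w"
  have "inv g w \<in> verts m"
    using w(1) G_aut[OF G_closed(3)[OF g]] by (simp add: aut_verts_iff)
  then have "\<not> prefix u (inv g w)"
    using w u aut_prefix_iff[OF G_aut[OF g], of u "inv g w"] by (simp add: bij_inv_cancel[OF G_bij[OF g]])
  then show "(g \<circ> a \<circ> inv g) w = w"
    using rist_fix[OF a] by (simp add: bij_inv_cancel[OF G_bij[OF g]])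
qed

section \<open>Orbits of rays\<close>

lemma act_comp: "g \<in> G \<Longrightarrow> h \<in> G \<Longrightarrow> \<xi> \<in> bd m \<Longrightarrow> act_bd (g \<circ> h) \<xi> = act_bd g (act_bd h \<xi>)"
  by (simp add: act_bd_comp[of m] G_aut G_closed)

abbreviation orb :: "autom set \<Rightarrow> ray \<Rightarrow> ray set" where
  "orb M \<xi> \<equiv> (\<lambda>g. act_bd g \<xi>) ` M"

text \<open>A nontrivial element moves some vertex \<open>u\<close> below the prefix, possibly off
  \<open>\<xi>\<close>. Conjugation by some \<open>t\<close> that carries \<open>u\<close> onto
  \<open>\<xi>\<close> repairs this; \<open>t\<close> fixes the prefix, which lies above both
  \<open>u\<close> and \<open>t u\<close>.\<close>

lemma rist_moves_ray:
  assumes xi: "\<xi> \<in> bd m"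
  shows "\<exists>g\<in>rist m G (pre \<xi> k). act_bd g \<xi> \<noteq> \<xi>"
proof -
  let ?w = "pre \<xi> k"
  obtain g where g: "g \<in> rist m G ?w" "g \<noteq> id"
    using rist_nontriv[OF pre_verts[OF xi]] rist_closed(1) by blast
  then obtain u where u: "g u \<noteq> u" by (auto simp: fun_eq_iff)
  then have uv: "u \<in> verts m" using aut_outside G_aut rist_G g(1) by blast
  let ?n = "length u"
  have "prefix ?w u" using rist_fix[OF g(1)] u by blast
  then have kn: "k \<le> ?n" "take k u = ?w" by (auto simp: prefix_take_iff)
  obtain t where t: "t \<in> G" "t u = pre \<xi> ?n"
    using transitive[of u ?n "pre \<xi> ?n"] uv pre_lev[OF xi] by (auto simp: lev_def)
  have "t ?w = take k (t u)" using aut_take[OF G_aut[OF t(1)] uv, of k] kn by simp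
  then have tw: "t ?w = ?w" using t(2) kn(1) by (simp add: take_pre)
  have mem: "t \<circ> g \<circ> inv t \<in> rist m G ?w"
    using rist_conj[OF t(1) g(1) pre_verts[OF xi]] tw by simp
  have "(t \<circ> g \<circ> inv t) (pre \<xi> ?n) = t (g u)"
    by (simp add: t(2)[symmetric] bij_inv_cancel[OF G_bij[OF t(1)]])
  moreover have "t (g u) \<noteq> t u" using u G_bij[OF t(1)] by (metis bij_inv_cancel(1))
  ultimately have "(t \<circ> g \<circ> inv t) (pre \<xi> ?n) \<noteq> pre \<xi> ?n" using t(2) by simp
  then have "act_bd (t \<circ> g \<circ> inv t) \<xi> \<noteq> \<xi>"
    using pre_act[OF G_aut[OF rist_G[OF mem]] xi] by metis
  with mem show ?thesis by blast
qed

lemma rays_separated: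
  assumes "finite X" shows "\<exists>k. \<forall>\<eta>\<in>X. \<forall>\<zeta>\<in>X. \<eta> \<noteq> \<zeta> \<longrightarrow> (\<forall>n\<ge>k. pre \<eta> n \<noteq> pre \<zeta> n)"
proof -
  have "\<exists>n. \<forall>j\<ge>n. pre \<eta> j \<noteq> pre \<zeta> j" if "\<eta> \<noteq> \<zeta>" for \<eta> \<zeta>
    using that ray_eqI pre_eq_mono by metis
  then obtain f where f: "\<And>\<eta> \<zeta> j. \<eta> \<noteq> \<zeta> \<Longrightarrow> j \<ge> f \<eta> \<zeta> \<Longrightarrow> pre \<eta> j \<noteq> pre \<zeta> j" by metis
  have "f \<eta> \<zeta> \<le> (\<Sum>(\<eta>, \<zeta>)\<in>X \<times> X. f \<eta> \<zeta>)" if "\<eta> \<in> X" "\<zeta> \<in> X" for \<eta> \<zeta>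
    using member_le_sum[of "(\<eta>, \<zeta>)" "X \<times> X" "\<lambda>(\<eta>, \<zeta>). f \<eta> \<zeta>"] that assms by auto
  then show ?thesis using f by (meson order_trans)
qed

text \<open>The rays of a finite orbit would be separated at some level, yet the rigid stabilizer of
  a prefix that long moves \<open>\<xi>\<close> without changing the prefix.\<close>

lemma rist_orbit_infinite:
  assumes xi: "\<xi> \<in> bd m" shows "infinite (orb (rist m G (pre \<xi> n)) \<xi>)"
proof
  assume fin: "finite (orb (rist m G (pre \<xi> n)) \<xi>)"
  obtain k where k: "\<And>\<eta> \<zeta> j. \<eta> \<in> orb (rist m G (pre \<xi> n)) \<xi> \<Longrightarrow> \<zeta> \<in> orb (rist m G (pre \<xi> n)) \<xi> \<Longrightarrow>
      \<eta> \<noteq> \<zeta> \<Longrightarrow> k \<le> j \<Longrightarrow> pre \<eta> j \<noteq> pre \<zeta> j"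
    using rays_separated[OF fin] by blast
  let ?j = "max k n"
  obtain g where g: "g \<in> rist m G (pre \<xi> ?j)" "act_bd g \<xi> \<noteq> \<xi>" using rist_moves_ray[OF xi] by blast
  have "g \<in> rist m G (pre \<xi> n)" using g(1) rist_mono[OF pre_prefix[of n ?j \<xi>]] by auto
  moreover have "\<xi> \<in> orb (rist m G (pre \<xi> n)) \<xi>"
    using rist_closed(1) by (metis act_bd_id imageI)
  ultimately have "pre (act_bd g \<xi>) ?j \<noteq> pre \<xi> ?j" using k g(2) by auto
  moreover have "pre (act_bd g \<xi>) ?j = pre \<xi> ?j"
    using pre_act[OF G_aut[OF rist_G[OF g(1)]] xi] rist_self[OF g(1)] by simp
  ultimately show False by simp
qed

text \<open>Finitely many translates of the orbit under \<open>M\<close> cover the infinite orbit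
  under the rigid stabilizer.\<close>

lemma finidx_orbit_infinite:
  assumes xi: "\<xi> \<in> bd m" and fin: "finidx (rist m G (pre \<xi> n)) M" and MG: "M \<subseteq> G"
  shows "infinite (orb M \<xi>)"
proof
  assume "finite (orb M \<xi>)"
  obtain F where F: "finite F" "F \<subseteq> rist m G (pre \<xi> n)"
    "\<And>\<gamma>. \<gamma> \<in> rist m G (pre \<xi> n) \<Longrightarrow> \<exists>f\<in>F. inv f \<circ> \<gamma> \<in> M"
    using fin by (auto simp: finidx_def)
  have "orb (rist m G (pre \<xi> n)) \<xi> \<subseteq> (\<Union>f\<in>F. act_bd f ` orb M \<xi>)"
  proof (intro image_subsetI)
    fix \<gamma> assume g: "\<gamma> \<in> rist m G (pre \<xi> n)"
    then obtain f where f: "f \<in> F" "inv f \<circ> \<gamma> \<in> M" using F(3) by blast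
    have fG: "f \<in> G" using f(1) F(2) rist_G by blast
    have "f \<circ> (inv f \<circ> \<gamma>) = \<gamma>" by (simp add: autom_group_simps G_bij[OF fG])
    then have "act_bd \<gamma> \<xi> = act_bd f (act_bd (inv f \<circ> \<gamma>) \<xi>)"
      using act_comp[OF fG, of "inv f \<circ> \<gamma>" \<xi>] f(2) MG xi by auto
    with f show "act_bd \<gamma> \<xi> \<in> (\<Union>f\<in>F. act_bd f ` orb M \<xi>)" by blast
  qed
  moreover have "finite (\<Union>f\<in>F. act_bd f ` orb M \<xi>)" using F(1) \<open>finite (orb M \<xi>)\<close> by blast
  ultimately show False using rist_orbit_infinite[OF xi] finite_subset by blast
qed

lemma infinite_orbit_obtain:
  assumes xi: "\<xi> \<in> bd m" and "infinite (orb M \<xi>)" "M \<subseteq> G"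
  shows "\<exists>x\<in>M. \<exists>y\<in>M. \<exists>k. \<forall>n\<ge>k. x (pre \<xi> n) \<noteq> pre \<xi> n \<and> y (pre \<xi> n) \<noteq> pre \<xi> n \<and> x (pre \<xi> n) \<noteq> y (pre \<xi> n)"
proof -
  have ne: "\<not> orb M \<xi> \<subseteq> X" if "finite X" for X
    using assms(2) that finite_subset by blast
  obtain x where x: "x \<in> M" "act_bd x \<xi> \<noteq> \<xi>" using ne[of "{\<xi>}"] by blast
  obtain y where y: "y \<in> M" "act_bd y \<xi> \<noteq> \<xi>" "act_bd y \<xi> \<noteq> act_bd x \<xi>"
    using ne[of "{\<xi>, act_bd x \<xi>}"] by blast
  obtain k where k: "\<forall>\<eta>\<in>{\<xi>, act_bd x \<xi>, act_bd y \<xi>}. \<forall>\<zeta>\<in>{\<xi>, act_bd x \<xi>, act_bd y \<xi>}. 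
      \<eta> \<noteq> \<zeta> \<longrightarrow> (\<forall>n\<ge>k. pre \<eta> n \<noteq> pre \<zeta> n)"
    using rays_separated[of "{\<xi>, act_bd x \<xi>, act_bd y \<xi>}"] by blast
  have p: "pre (act_bd x \<xi>) n = x (pre \<xi> n)" "pre (act_bd y \<xi>) n = y (pre \<xi> n)" for n
    using pre_act[OF G_aut xi] x(1) y(1) assms(3) by auto
  show ?thesis
  proof (intro bexI exI allI impI)
    show "x (pre \<xi> n) \<noteq> pre \<xi> n \<and> y (pre \<xi> n) \<noteq> pre \<xi> n \<and> x (pre \<xi> n) \<noteq> y (pre \<xi> n)" if "n \<ge> k" for n
      unfolding p[symmetric] using k x y that by (metis insertI1 insertI2)
  qed (use x y in auto)
qed

text \<open>The final membership says that \<open>inv g \<circ> s \<circ> g\<close> lies in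
  \<open>conj \<gamma> H\<close>. The point is that one finite \<open>\<Gamma>\<close> serves all
  \<open>\<gamma>\<close> fixing level \<open>n\<close>: its elements become the colours in
  \<open>shadow_finidx\<close>.\<close>

definition recurrent :: "autom set \<Rightarrow> bool" where
  "recurrent H \<longleftrightarrow> (\<forall>S n. finite S \<and> S \<subseteq> H \<longrightarrow> (\<exists>\<Gamma>. finite \<Gamma> \<and> \<Gamma> \<subseteq> G \<and> (\<forall>g\<in>\<Gamma>. \<forall>v\<in>lev m n. g v = v)
     \<and> (\<forall>\<gamma>\<in>G. (\<forall>v\<in>lev m n. \<gamma> v = v) \<longrightarrow> (\<exists>g\<in>\<Gamma>. \<forall>s\<in>S. inv \<gamma> \<circ> (inv g \<circ> s \<circ> g) \<circ> \<gamma> \<in> H))))"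

text \<open>For a single \<open>x\<close> with \<open>x w \<noteq> w\<close>, this is the projection
  to \<open>rist m G w\<close> of those elements of \<open>H\<close> that are products from the
  rigid stabilizers of \<open>w\<close> and \<open>x w\<close>; for several \<open>x\<close> the
  projections are intersected.\<close>

definition shadow :: "autom set \<Rightarrow> vert \<Rightarrow> autom set \<Rightarrow> autom set" where
  "shadow H w S = {k \<in> rist m G w. \<forall>x\<in>S. \<exists>e\<in>rist m G (x w). k \<circ> e \<in> H}"

text \<open>Since \<open>w\<close> and \<open>x w\<close> are independent, the two factors commute
  and the projection to the first is multiplicative.\<close>

lemma shadow_subgroup:
  assumes H: "is_subgroup H" and S: "S \<subseteq> G" "\<And>x. x \<in> S \<Longrightarrow> x w \<noteq> w" and w: "w \<in> verts m"
  shows "is_subgroup (shadow H w S)"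
  unfolding is_subgroup_def
proof (intro conjI ballI)
  show "id \<in> shadow H w S"
    using is_subgroupD(1)[OF H] by (auto simp: shadow_def rist_closed(1) intro!: bexI[of _ id])
  have ind: "indep w (x w)" if "x \<in> S" for x
    using S(1) S(2)[OF that] that aut_length[OF G_aut, of x w] by (auto intro!: indep_same_length)
  fix k assume k: "k \<in> shadow H w S"
  {
    fix l assume l: "l \<in> shadow H w S"
    have "\<exists>e\<in>rist m G (x w). (k \<circ> l) \<circ> e \<in> H" if x: "x \<in> S" for x
    proof -
      obtain e e' where e: "e \<in> rist m G (x w)" "k \<circ> e \<in> H" "e' \<in> rist m G (x w)" "l \<circ> e' \<in> H"
        using k l x unfolding shadow_def by blast
      have "e \<circ> l = l \<circ> e" using rist_commute[OF _ e(1) ind[OF x]] l by (auto simp: shadow_def)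
      then have "(k \<circ> l) \<circ> (e \<circ> e') = (k \<circ> e) \<circ> (l \<circ> e')" by (metis comp_assoc)
      then show ?thesis using e is_subgroupD(2)[OF H] rist_closed(2) by metis
    qed
    then show "k \<circ> l \<in> shadow H w S" using k l rist_closed(2) by (auto simp: shadow_def)
  }
  have "\<exists>e\<in>rist m G (x w). inv k \<circ> e \<in> H" if x: "x \<in> S" for x
  proof -
    obtain e where e: "e \<in> rist m G (x w)" "k \<circ> e \<in> H" using k x unfolding shadow_def by blast
    have kr: "k \<in> rist m G w" using k by (simp add: shadow_def)
    have "inv k \<circ> inv e = inv (e \<circ> k)" 
      using G_bij[OF rist_G[OF kr]] G_bij[OF rist_G[OF e(1)]] by (simp add: o_inv_distrib)
    also have "e \<circ> k = k \<circ> e" using rist_commute[OF kr e(1) ind[OF x]] by simp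
    finally show ?thesis using e is_subgroupD(3)[OF H] rist_closed(3) by metis
  qed
  then show "inv k \<in> shadow H w S" using k rist_closed(3) by (auto simp: shadow_def)
qed

text \<open>Colour \<open>\<gamma>\<close> by some \<open>g \<in> \<Gamma>\<close> that serves it.
  If \<open>\<gamma>\<close> and \<open>\<delta>\<close> share \<open>g\<close> and
  \<open>x = inv g \<circ> s \<circ> g\<close>, then
  \<open>inv \<gamma> \<circ> x \<circ> \<gamma>\<close> times the inverse of
  \<open>inv \<delta> \<circ> x \<circ> \<delta>\<close> is in \<open>H\<close>; its component at
  \<open>w\<close> is \<open>inv \<gamma> \<circ> \<delta>\<close> and the rest lives at
  \<open>s w\<close>.\<close>

lemma shadow_finidx:
  assumes rec: "recurrent H" and H: "is_subgroup H" "H \<subseteq> G"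
    and S: "finite S" "S \<subseteq> H" "\<And>x. x \<in> S \<Longrightarrow> x w \<noteq> w" and w: "w \<in> lev m n"
  shows "finidx (rist m G w) (shadow H w S)"
proof -
  from rec[unfolded recurrent_def, THEN spec, of S, THEN spec, of n, THEN mp, OF conjI[OF S(1,2)]]
  obtain \<Gamma> where \<Gamma>0: "finite \<Gamma> \<and> \<Gamma> \<subseteq> G \<and> (\<forall>g\<in>\<Gamma>. \<forall>v\<in>lev m n. g v = v)
     \<and> (\<forall>\<gamma>\<in>G. (\<forall>v\<in>lev m n. \<gamma> v = v) \<longrightarrow> (\<exists>g\<in>\<Gamma>. \<forall>s\<in>S. inv \<gamma> \<circ> (inv g \<circ> s \<circ> g) \<circ> \<gamma> \<in> H))" ..
  then have \<Gamma>: "finite \<Gamma>" "\<Gamma> \<subseteq> G" "\<And>g v. g \<in> \<Gamma> \<Longrightarrow> v \<in> lev m n \<Longrightarrow> g v = v"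
    and \<Gamma>4: "\<And>\<gamma>. \<gamma> \<in> G \<Longrightarrow> (\<forall>v\<in>lev m n. \<gamma> v = v) \<Longrightarrow> \<exists>g\<in>\<Gamma>. \<forall>s\<in>S. inv \<gamma> \<circ> (inv g \<circ> s \<circ> g) \<circ> \<gamma> \<in> H"
    by blast+
  have wv: "w \<in> verts m" "length w = n" using w by (auto simp: lev_def)
  \<comment> \<open>Elements of \<open>rist m G w\<close> fix all of level \<open>n\<close>, so
    recurrence applies to them.\<close>
  have "\<exists>g\<in>\<Gamma>. \<forall>s\<in>S. inv \<gamma> \<circ> (inv g \<circ> s \<circ> g) \<circ> \<gamma> \<in> H" if "\<gamma> \<in> rist m G w" for \<gamma>
    by (rule \<Gamma>4[OF rist_G[OF that]]) (use rist_low[OF that] wv in \<open>auto simp: lev_def\<close>)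
  then obtain c where c: "\<And>\<gamma>. \<gamma> \<in> rist m G w \<Longrightarrow> c \<gamma> \<in> \<Gamma>"
    "\<And>\<gamma> s. \<gamma> \<in> rist m G w \<Longrightarrow> s \<in> S \<Longrightarrow> inv \<gamma> \<circ> (inv (c \<gamma>) \<circ> s \<circ> c \<gamma>) \<circ> \<gamma> \<in> H"
    by metis
  show ?thesis
  proof (rule finidx_coloring[OF \<Gamma>(1) c(1)])
    fix \<gamma> \<delta> assume gd: "\<gamma> \<in> rist m G w" "\<delta> \<in> rist m G w" "c \<gamma> = c \<delta>"
    have "\<exists>e\<in>rist m G (s w). (inv \<gamma> \<circ> \<delta>) \<circ> e \<in> H" if s: "s \<in> S" for s
    proof -
      define x where "x = inv (c \<gamma>) \<circ> s \<circ> c \<gamma>"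
      have cG: "c \<gamma> \<in> G" using c(1)[OF gd(1)] \<Gamma>(2) by blast
      have sG: "s \<in> G" using s S(2) H(2) by blast
      have xG: "x \<in> G" using cG sG G_closed by (simp add: x_def)
      \<comment> \<open>Both \<open>w\<close> and \<open>s w\<close> lie on level \<open>n\<close>,
        which \<open>c \<gamma>\<close> fixes pointwise; hence \<open>x\<close> and \<open>s\<close>
        agree at \<open>w\<close>.\<close>
      have "c \<gamma> w = w" using \<Gamma>(3)[OF c(1)[OF gd(1)] w] .
      moreover have "c \<gamma> (s w) = s w" using \<Gamma>(3)[OF c(1)[OF gd(1)]] aut_lev[OF G_aut[OF sG]] w by blast
      ultimately have xw: "x w = s w"
        unfolding x_def by (metis G_bij[OF cG] bij_inv_cancel(1) comp_apply)
      define e where "e = x \<circ> (\<gamma> \<circ> inv \<delta>) \<circ> inv x"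
      have er: "e \<in> rist m G (s w)"
        unfolding e_def xw[symmetric] by (intro rist_conj xG rist_closed gd wv)
      have ind: "indep w (s w)"
        using S(3)[OF s] aut_length[OF G_aut[OF sG]] by (simp add: indep_same_length)
      have b: "bij \<gamma>" "bij \<delta>" "bij x" using gd xG rist_G G_bij by auto
      have "(inv \<gamma> \<circ> \<delta>) \<circ> e = inv \<gamma> \<circ> (e \<circ> \<delta>)" using rist_commute[OF gd(2) er ind] by (simp add: comp_assoc)
      also have "\<dots> = (inv \<gamma> \<circ> x \<circ> \<gamma>) \<circ> inv (inv \<delta> \<circ> x \<circ> \<delta>)"
        using b by (simp add: e_def autom_group_simps)
      also have "\<dots> \<in> H"
        by (rule is_subgroupD(2)[OF H(1) _ is_subgroupD(3)[OF H(1)]])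
          (use c(2)[OF gd(1) s] c(2)[OF gd(2) s] gd(3) in \<open>simp_all add: x_def\<close>)
      finally show ?thesis using er by blast
    qed
    then show "inv \<gamma> \<circ> \<delta> \<in> shadow H w S" using gd rist_closed by (simp add: shadow_def)
  qed
qed

text \<open>For a prefix \<open>w\<close> moved by \<open>h\<close>, the shadow of \<open>h\<close>
  has finite index in \<open>rist m G w\<close>, hence an infinite orbit on \<open>\<xi>\<close>.
  The partner \<open>e\<close> of a shadow element \<open>k\<close> acts below \<open>h w\<close>,
  off the ray, so \<open>k \<circ> e \<in> H\<close> moves \<open>\<xi>\<close> as \<open>k\<close>
  does.\<close>

lemma not_fixed_orbit_infinite:
  assumes rec: "recurrent H" and H: "is_subgroup H" "H \<subseteq> G"
    and xi: "\<xi> \<in> bd m" "\<xi> \<notin> Fix m H"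
  shows "infinite (orb H \<xi>)"
proof -
  obtain h n where h: "h \<in> H" "h (pre \<xi> n) \<noteq> pre \<xi> n"
    using xi Fix_iff[of H m \<xi>] H(2) G_aut by blast
  let ?w = "pre \<xi> n"
  have hG: "h \<in> G" using h H by blast
  have ind: "indep ?w (h ?w)"
    using h(2) aut_length[OF G_aut[OF hG], of ?w] by (intro indep_same_length) auto
  have "finidx (rist m G ?w) (shadow H ?w {h})"
    by (rule shadow_finidx[OF rec H]) (use h pre_lev[OF xi(1)] in auto)
  then have "infinite (orb (shadow H ?w {h}) \<xi>)"
    by (rule finidx_orbit_infinite[OF xi(1)]) (auto simp: shadow_def rist_G)
  moreover have "orb (shadow H ?w {h}) \<xi> \<subseteq> orb H \<xi>"
  proof (intro image_subsetI)
    fix k assume "k \<in> shadow H ?w {h}"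
    then obtain e where k: "k \<in> rist m G ?w" "e \<in> rist m G (h ?w)" "k \<circ> e \<in> H" by (auto simp: shadow_def)
    have "e (pre \<xi> j) = pre \<xi> j" for j
    proof (rule rist_fix[OF k(2)])
      have "prefix ?w (pre \<xi> j) \<or> prefix (pre \<xi> j) ?w" by (metis linear pre_prefix)
      then show "\<not> prefix (h ?w) (pre \<xi> j)"
        using ind unfolding indep_def by (meson prefix_order.trans prefix_same_cases)
    qed
    then have "act_bd k \<xi> = act_bd (k \<circ> e) \<xi>"
      using act_eq_iff[OF G_aut G_aut xi(1), of k "k \<circ> e"] k rist_G H by auto
    then show "act_bd k \<xi> \<in> orb H \<xi>" using k(3) by auto
  qed
  ultimately show ?thesis using finite_subset by blast
qed

lemma rist_derived_subset:
  assumes rec: "recurrent H" and H: "is_subgroup H" "H \<subseteq> G"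
    and xi: "\<xi> \<in> bd m" "\<xi> \<notin> Fix m H"
  shows "\<exists>k. derived (rist m G (pre \<xi> k)) \<subseteq> H"
proof -
  \<comment> \<open>Two elements are needed to have the three distinct vertices \<open>w\<close>,
    \<open>x w\<close>, \<open>y w\<close>, with room for two independent correction
    factors.\<close>
  obtain x y n where xy: "x \<in> H" "y \<in> H" "x (pre \<xi> n) \<noteq> pre \<xi> n" "y (pre \<xi> n) \<noteq> pre \<xi> n" "x (pre \<xi> n) \<noteq> y (pre \<xi> n)"
    using infinite_orbit_obtain[OF xi(1) not_fixed_orbit_infinite[OF assms] H(2)] by blast
  define w where "w = pre \<xi> n"
  have w: "w \<in> verts m" "w \<in> lev m n" using pre_verts[OF xi(1)] pre_lev[OF xi(1)] by (auto simp: w_def)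
  define M where "M = shadow H w {x, y}"
  \<comment> \<open>Conjugates of elements of the core by \<open>rist m G w\<close>, and so by
    \<open>rist m G u\<close> for \<open>u\<close> below \<open>w\<close>, stay in \<open>M\<close>;
    finite index keeps the orbit of \<open>\<xi>\<close> under the core infinite.\<close>
  define B where "B = core (rist m G w) M"
  have xyG: "x \<in> G" "y \<in> G" using xy H by auto
  have M: "is_subgroup M" "finidx (rist m G w) M"
    unfolding M_def using xy H w xyG by (auto simp: w_def intro!: shadow_subgroup shadow_finidx[OF rec])
  have MR: "M \<subseteq> rist m G w" by (auto simp: M_def shadow_def)
  have rb: "g \<in> rist m G w \<Longrightarrow> bij g" for g using G_bij rist_G by blast
  have B: "is_subgroup B" "finidx (rist m G w) B"
    unfolding B_def by (intro core_subgroup core_finidx rist_subgroup M MR rb; assumption)+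
  have BR: "B \<subseteq> rist m G w" by (auto simp: B_def core_def)
  have BM: "B \<subseteq> M"
    using rist_closed(1)[of w] by (force simp: B_def core_def)
  have BG: "B \<subseteq> G" using BR rist_G by blast
  have "infinite (orb B \<xi>)"
    using finidx_orbit_infinite[OF xi(1) _ BG] B(2) by (simp add: w_def)
  then obtain g1 g2 k0 where g: "g1 \<in> B" "g2 \<in> B"
    and k0: "\<And>j. j \<ge> k0 \<Longrightarrow> g1 (pre \<xi> j) \<noteq> pre \<xi> j \<and> g2 (pre \<xi> j) \<noteq> pre \<xi> j \<and> g1 (pre \<xi> j) \<noteq> g2 (pre \<xi> j)"
    using infinite_orbit_obtain[OF xi(1) _ BG] by blast
  \<comment> \<open>At least \<open>k0\<close> so that \<open>u\<close>, \<open>g1 u\<close>,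
    \<open>g2 u\<close> are distinct, and at least \<open>n\<close> so that \<open>u\<close> extends
    \<open>w\<close>.\<close>
  define k where "k = max k0 n"
  define u where "u = pre \<xi> k"
  have u: "u \<in> verts m" using pre_verts[OF xi(1)] by (simp add: u_def)
  have wu: "prefix w u" by (simp add: w_def u_def k_def pre_prefix)
  have gu: "prefix w (g1 u)" "prefix w (g2 u)" using g BR wu rist_prefix by blast+
  have gG: "g1 \<in> G" "g2 \<in> G" using g BG by auto
  have len: "length (g1 u) = length u" "length (g2 u) = length u" "length (x w) = length w" "length (y w) = length w"
    using aut_length G_aut gG xyG by auto
  have ind0: "indep u (g1 u)" "indep u (g2 u)" "indep (g1 u) (g2 u)"
    using k0[of k] len by (auto simp: u_def k_def intro!: indep_same_length)
  have indw: "indep w (x w)" "indep w (y w)" "indep (x w) (y w)"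
    using xy(3-5) len by (auto simp: w_def[symmetric] intro!: indep_same_length)
  have inds: "indep z (x w)" "indep z (y w)" if "prefix w z" for z
    using indw that by (auto intro: indep_extend)
  have comm: "a \<circ> b \<circ> inv a \<circ> inv b \<in> H" if ab: "a \<in> rist m G u" "b \<in> rist m G u" for a b
  proof -
    \<comment> \<open>The commutator of \<open>c\<close> and \<open>\<gamma>\<close> is
      \<open>c \<circ> d\<close> with \<open>d\<close> supported below \<open>\<gamma> u\<close>. It
      lies in \<open>M\<close>, so some \<open>e\<close> completes it to an element of
      \<open>H\<close>.\<close>
    have part: "\<exists>d e. d \<in> rist m G (\<gamma> u) \<and> e \<in> rist m G (z w) \<and> c \<circ> (d \<circ> e) \<in> H"
      if c: "c \<in> rist m G u" and \<gamma>: "\<gamma> \<in> B" and z: "z \<in> {x, y}" for c \<gamma> z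
    proof -
      define d where "d = \<gamma> \<circ> inv c \<circ> inv \<gamma>"
      have \<gamma>G: "\<gamma> \<in> G" using \<gamma> BG by blast
      have d: "d \<in> rist m G (\<gamma> u)" unfolding d_def by (intro rist_conj \<gamma>G rist_closed c u)
      have cw: "c \<in> rist m G w" using c rist_mono[OF wu] by blast
      have "c \<circ> \<gamma> \<circ> inv c \<in> M"
        using \<gamma> rist_closed(3)[OF cw] rb[OF cw] by (auto simp: B_def core_def inv_inv_eq dest: bspec[of _ _ "inv c"])
      then have "(c \<circ> \<gamma> \<circ> inv c) \<circ> inv \<gamma> \<in> M"
        by (rule is_subgroupD(2)[OF M(1) _ is_subgroupD(3)[OF M(1)]]) (use \<gamma> BM in blast)
      then have "c \<circ> d \<in> M" by (simp add: d_def comp_assoc)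
      then obtain e where "e \<in> rist m G (z w)" "(c \<circ> d) \<circ> e \<in> H"
        using z by (auto simp: M_def shadow_def)
      with d show ?thesis by (metis comp_assoc)
    qed
    \<comment> \<open>Pairing \<open>a\<close> with \<open>g1\<close>, \<open>x\<close> and
      \<open>b\<close> with \<open>g2\<close>, \<open>y\<close> places the unwanted factors over
      independent vertices, so they vanish from the commutator.\<close>
    obtain d e where de: "d \<in> rist m G (g1 u)" "e \<in> rist m G (x w)" "a \<circ> (d \<circ> e) \<in> H"
      using part[OF ab(1) g(1), of x] by blast
    obtain d' e' where de': "d' \<in> rist m G (g2 u)" "e' \<in> rist m G (y w)" "b \<circ> (d' \<circ> e') \<in> H"
      using part[OF ab(2) g(2), of y] by blast
    have b: "bij a" "bij b" "bij (d \<circ> e)" "bij (d' \<circ> e')"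
      using ab de de' G_bij rist_G bij_comp by blast+
    have cm: "d \<circ> b = b \<circ> d" "e \<circ> b = b \<circ> e" "d \<circ> d' = d' \<circ> d" "d \<circ> e' = e' \<circ> d" "e \<circ> d' = d' \<circ> e" "e \<circ> e' = e' \<circ> e"
        "d' \<circ> a = a \<circ> d'" "e' \<circ> a = a \<circ> e'"
      by (rule rist_commute[OF de(1) ab(2) indep_sym[OF ind0(1)]]
        rist_commute[OF de(2) ab(2) indep_sym[OF inds(1)[OF wu]]]
        rist_commute[OF de(1) de'(1) ind0(3)]
        rist_commute[OF de(1) de'(2) inds(2)[OF gu(1)]]
        rist_commute[OF de(2) de'(1) indep_sym[OF inds(1)[OF gu(2)]]]
        rist_commute[OF de(2) de'(2) indw(3)]
        rist_commute[OF de'(1) ab(1) indep_sym[OF ind0(2)]]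
        rist_commute[OF de'(2) ab(1) indep_sym[OF inds(2)[OF wu]]])+
    have "(a \<circ> (d \<circ> e)) \<circ> (b \<circ> (d' \<circ> e')) \<circ> inv (a \<circ> (d \<circ> e)) \<circ> inv (b \<circ> (d' \<circ> e')) = a \<circ> b \<circ> inv a \<circ> inv b"
    proof (rule commutator_perturb[OF b])
      show "(d \<circ> e) \<circ> b = b \<circ> (d \<circ> e)" using cm by (metis comp_assoc)
      show "(d \<circ> e) \<circ> (d' \<circ> e') = (d' \<circ> e') \<circ> (d \<circ> e)" using cm by (simp add: fun_eq_iff)
      show "(d' \<circ> e') \<circ> a = a \<circ> (d' \<circ> e')" using cm by (metis comp_assoc)
    qed
    then show ?thesis using de(3) de'(3) is_subgroupD[OF H(1)] by metis
  qed
  have "derived (rist m G u) \<subseteq> H"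
    unfolding derived_def gen_subgroup_def using comm H(1) by blast
  then show ?thesis unfolding u_def by blast
qed

end

subsection \<open>The Chabauty space and minimality\<close>

text \<open>Alexander's subbase theorem. What remains is to identify its topology, formed relative
  to \<open>\<Union>B\<close>, with \<open>topology_generated_by B\<close>.\<close>

lemma compact_space_generated:
  assumes fin: "\<And>C. C \<subseteq> B \<Longrightarrow> \<Union>C = \<Union>B \<Longrightarrow> \<exists>C'. finite C' \<and> C' \<subseteq> C \<and> \<Union>C' = \<Union>B"
  shows "compact_space (topology_generated_by B)"
proof (rule Alexander_subbase[where \<B>=B])
  let ?T = "topology (arbitrary union_of (finite intersection_of (\<lambda>x. x \<in> B) relative_to \<Union>B))"
  show "?T = topology_generated_by B"
    unfolding topology_eq
  proof (intro allI iffI)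
    fix S
    assume "openin (topology_generated_by B) S"
    then have "generate_topology_on B S" by (rule openin_topology_generated_by)
    then show "openin ?T S"
    proof (induction rule: generate_topology_on.induct)
      case (Basis s)
      then have "(finite intersection_of (\<lambda>x. x \<in> B) relative_to \<Union>B) (\<Union>B \<inter> s)"
        by (intro relative_to_inc finite_intersection_of_inc)
      moreover have "\<Union>B \<inter> s = s" using Basis by blast
      ultimately show ?case unfolding openin_subbase by (simp add: arbitrary_union_of_inc)
    qed (auto intro: openin_Int openin_Union)
  next
    fix S
    assume "openin ?T S"
    then obtain \<U> where \<U>: "\<Union>\<U> = S" "\<And>U. U \<in> \<U> \<Longrightarrow> (finite intersection_of (\<lambda>x. x \<in> B) relative_to \<Union>B) U"
      unfolding openin_subbase unfolding union_of_def arbitrary_def by blast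
    have "openin (topology_generated_by B) U" if mem: "U \<in> \<U>" for U
    proof -
      obtain \<F> where \<F>: "finite \<F>" "\<F> \<subseteq> B" "U = \<Union>B \<inter> \<Inter>\<F>"
        using \<U>(2)[OF mem] unfolding relative_to_def intersection_of_def by auto
      have "openin (topology_generated_by B) (topspace (topology_generated_by B) \<inter> \<Inter>\<F>)"
        by (rule openin_Int_Inter[OF \<F>(1) openin_topspace]) (use \<F>(2) topology_generated_by_Basis in blast)
      then show ?thesis using \<F>(3) by simp
    qed
    then show "openin (topology_generated_by B) S" using \<U>(1) by blast
  qed
qed (use fin in simp)

text \<open>With \<open>openin_Collect_bex\<close> this reduces openness to logical form: finite
  universal and arbitrary existential quantifiers over open conditions.\<close>

lemma openin_Collect_ball:
  assumes "finite A" "\<And>t. t \<in> A \<Longrightarrow> openin X {x \<in> topspace X. P t x}"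
  shows "openin X {x \<in> topspace X. \<forall>t\<in>A. P t x}"
  using assms
proof (induction A rule: finite_induct)
  case (insert a A)
  have "{x \<in> topspace X. \<forall>t\<in>insert a A. P t x} = {x \<in> topspace X. P a x} \<inter> {x \<in> topspace X. \<forall>t\<in>A. P t x}"
    by auto
  with insert show ?case by auto
qed simp

lemma openin_Collect_bex:
  assumes "\<And>t. t \<in> A \<Longrightarrow> openin X {x \<in> topspace X. P t x}"
  shows "openin X {x \<in> topspace X. \<exists>t\<in>A. P t x}"
proof -
  have "{x \<in> topspace X. \<exists>t\<in>A. P t x} = \<Union>((\<lambda>t. {x \<in> topspace X. P t x}) ` A)" by auto
  then show ?thesis using assms by auto
qed

section \<open>Generated subgroups and conjugation\<close>

lemma gen_subgroup_is_subgroup: "is_subgroup (gen_subgroup S)"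
  unfolding is_subgroup_def gen_subgroup_def by auto

lemma gen_subgroup_incl: "S \<subseteq> gen_subgroup S"
  unfolding gen_subgroup_def by blast

lemma gen_subgroup_least: "is_subgroup H \<Longrightarrow> S \<subseteq> H \<Longrightarrow> gen_subgroup S \<subseteq> H"
  unfolding gen_subgroup_def by blast

lemma gen_subgroup_mono: "S \<subseteq> T \<Longrightarrow> gen_subgroup S \<subseteq> gen_subgroup T"
  unfolding gen_subgroup_def by blast

text \<open>The elements generated by finite subsets of \<open>S\<close> already form a subgroup
  containing \<open>S\<close>.\<close>

lemma gen_subgroup_finite:
  assumes "a \<in> gen_subgroup S"
  shows "\<exists>F. finite F \<and> F \<subseteq> S \<and> a \<in> gen_subgroup F"
proof -
  let ?T = "{a. \<exists>F. finite F \<and> F \<subseteq> S \<and> a \<in> gen_subgroup F}"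
  note sub = is_subgroupD[OF gen_subgroup_is_subgroup]
  have "is_subgroup ?T"
    unfolding is_subgroup_def
  proof (intro conjI ballI)
    show "id \<in> ?T" using sub(1) by blast
    fix a assume "a \<in> ?T"
    then obtain F where F: "finite F" "F \<subseteq> S" "a \<in> gen_subgroup F" by blast
    then show "inv a \<in> ?T" using sub(3) by blast
    fix b assume "b \<in> ?T"
    then obtain F' where F': "finite F'" "F' \<subseteq> S" "b \<in> gen_subgroup F'" by blast
    have "a \<circ> b \<in> gen_subgroup (F \<union> F')"
      using F(3) F'(3) gen_subgroup_mono[of F "F \<union> F'"] gen_subgroup_mono[of F' "F \<union> F'"]
      by (intro sub(2)) auto
    moreover have "finite (F \<union> F')" "F \<union> F' \<subseteq> S" using F F' by auto
    ultimately show "a \<circ> b \<in> ?T" by blast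
  qed
  moreover have "S \<subseteq> ?T"
  proof
    fix s assume "s \<in> S"
    then show "s \<in> ?T" using gen_subgroup_incl[of "{s}"] by (intro CollectI exI[of _ "{s}"]) auto
  qed
  ultimately have "gen_subgroup S \<subseteq> ?T" by (rule gen_subgroup_least)
  with assms show ?thesis by blast
qed

lemma mem_conj_iff: assumes g: "bij g" shows "x \<in> conj g K \<longleftrightarrow> inv g \<circ> x \<circ> g \<in> K"
proof
  assume "x \<in> conj g K"
  then obtain h where h: "h \<in> K" "x = g \<circ> h \<circ> inv g" by (auto simp: conj_def)
  have "inv g \<circ> x \<circ> g = h" using g by (simp add: h(2) autom_group_simps)
  then show "inv g \<circ> x \<circ> g \<in> K" using h(1) by simp
next
  assume "inv g \<circ> x \<circ> g \<in> K"
  moreover have "x = g \<circ> (inv g \<circ> x \<circ> g) \<circ> inv g" using g by (simp add: autom_group_simps)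
  ultimately show "x \<in> conj g K" unfolding conj_def image_iff by blast
qed

lemma conj_conj_inv: assumes g: "bij g" shows "conj (inv g) (conj g K) = K"
proof (rule set_eqI)
  fix x
  have "inv g \<circ> (g \<circ> x \<circ> inv g) \<circ> g = x" using g by (simp add: autom_group_simps)
  then show "x \<in> conj (inv g) (conj g K) \<longleftrightarrow> x \<in> K"
    using g by (simp add: mem_conj_iff bij_imp_bij_inv inv_inv_eq)
qed

context weakly_branch_group
begin

lemma topspace_chabauty: "topspace (chabauty G) = subgroups_of G"
  using G_closed(1) unfolding chabauty_def by auto

lemma openin_chabauty:
  assumes "g \<in> G"
  shows "openin (chabauty G) {H \<in> subgroups_of G. g \<in> H}" "openin (chabauty G) {H \<in> subgroups_of G. g \<notin> H}"
  unfolding chabauty_def by (rule topology_generated_by_Basis; use assms in blast)+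

text \<open>In a subbasic cover let \<open>S\<close> collect the \<open>g\<close> whose exclusion
  set \<open>?N g\<close> occurs. The subgroup generated by \<open>S\<close> can only be covered by
  some \<open>?P a\<close>, so a finite \<open>F \<subseteq> S\<close> generates \<open>a\<close>.
  Every subgroup either misses an element of \<open>F\<close> or contains \<open>F\<close> and hence
  \<open>a\<close>.\<close>

lemma compact_chabauty: "compact_space (chabauty G)"
  unfolding chabauty_def
proof (rule compact_space_generated)
  let ?P = "\<lambda>g. {H \<in> subgroups_of G. g \<in> H}" and ?N = "\<lambda>g. {H \<in> subgroups_of G. g \<notin> H}"
  let ?B = "{?P g | g. g \<in> G} \<union> {?N g | g. g \<in> G}"
  fix C assume C: "C \<subseteq> ?B" "\<Union>C = \<Union>?B"
  have UB: "\<Union>?B = subgroups_of G" using G_closed(1) by auto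
  define S where "S = {g \<in> G. ?N g \<in> C}"
  have "S \<subseteq> G" by (auto simp: S_def)
  then have "gen_subgroup S \<in> subgroups_of G"
    using gen_subgroup_is_subgroup gen_subgroup_least[OF G_subgroup] by (simp add: subgroups_of_def)
  then have "gen_subgroup S \<in> \<Union>C" unfolding C(2) UB .
  then obtain U where U: "U \<in> C" "gen_subgroup S \<in> U" by (rule UnionE)
  have "\<exists>a\<in>G. U = ?P a"
  proof (rule ccontr)
    assume "\<not> ?thesis"
    moreover have "U \<in> ?B" using U(1) C(1) by (rule set_mp[rotated])
    ultimately obtain g where g: "g \<in> G" "U = ?N g" by blast
    then have "g \<in> S" using U(1) by (simp add: S_def)
    then have "g \<in> gen_subgroup S" using gen_subgroup_incl by blast
    then show False using U(2) g(2) by simp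
  qed
  then obtain a where a: "U = ?P a" by blast
  then have "a \<in> gen_subgroup S" using U(2) by simp
  then obtain F where F: "finite F" "F \<subseteq> S" "a \<in> gen_subgroup F" using gen_subgroup_finite by blast
  let ?C = "insert U (?N ` F)"
  have sub: "?C \<subseteq> C" using F(2) U(1) by (auto simp: S_def)
  have "K \<in> \<Union>?C" if K: "K \<in> subgroups_of G" for K
  proof (cases "F \<subseteq> K")
    case True
    then have "a \<in> K" using F(3) gen_subgroup_least[of K F] K by (auto simp: subgroups_of_def)
    then show ?thesis using a K by simp
  qed (use K in auto)
  then have "subgroups_of G \<subseteq> \<Union>?C" by blast
  moreover have "\<Union>?C \<subseteq> \<Union>C" using sub by (rule Union_mono)
  ultimately have "\<Union>?C = \<Union>?B" unfolding C(2) UB by (intro equalityI)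
  moreover have "finite ?C" using F(1) by simp
  ultimately show "\<exists>C'. finite C' \<and> C' \<subseteq> C \<and> \<Union>C' = \<Union>?B" using sub by blast
qed

end

section \<open>Uniformly recurrent subgroups as minimal compact systems\<close>

locale weakly_branch_URS = weakly_branch_group +
  fixes \<H> :: "autom set set"
  assumes urs: "is_URS G \<H>"
begin

abbreviation X :: "autom set topology" where
  "X \<equiv> subtopology (chabauty G) \<H>"

lemma URS_sub: "\<H> \<subseteq> subgroups_of G"
  and URS_nonempty: "\<H> \<noteq> {}"
  and URS_closed: "closedin (chabauty G) \<H>"
  and URS_conj: "g \<in> G \<Longrightarrow> K \<in> \<H> \<Longrightarrow> conj g K \<in> \<H>"
  using urs unfolding is_URS_def G_invariant_sub_def by auto

lemma URS_subgroup: "K \<in> \<H> \<Longrightarrow> is_subgroup K" "K \<in> \<H> \<Longrightarrow> K \<subseteq> G"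
  using URS_sub by (auto simp: subgroups_of_def)

lemma topspace_X: "topspace X = \<H>"
  using URS_sub by (simp add: topspace_chabauty Int_absorb1)

lemma compact_X: "compact_space X"
  using closedin_compact_space[OF compact_chabauty URS_closed] by (rule compact_space_subtopology)

lemma openin_mem:
  assumes "g \<in> G" shows "openin X {K \<in> \<H>. g \<in> K}" "openin X {K \<in> \<H>. g \<notin> K}"
proof -
  have "{K \<in> \<H>. g \<in> K} = {K \<in> subgroups_of G. g \<in> K} \<inter> \<H>" "{K \<in> \<H>. g \<notin> K} = {K \<in> subgroups_of G. g \<notin> K} \<inter> \<H>"
    using URS_sub by auto
  then show "openin X {K \<in> \<H>. g \<in> K}" "openin X {K \<in> \<H>. g \<notin> K}"
    using openin_chabauty[OF assms] unfolding openin_subtopology by blast+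
qed

lemma openin_ball:
  "finite A \<Longrightarrow> (\<And>t. t \<in> A \<Longrightarrow> openin X {K \<in> \<H>. P t K}) \<Longrightarrow> openin X {K \<in> \<H>. \<forall>t\<in>A. P t K}"
  using openin_Collect_ball[of A X P] unfolding topspace_X .

lemma openin_bex:
  "(\<And>t. t \<in> A \<Longrightarrow> openin X {K \<in> \<H>. P t K}) \<Longrightarrow> openin X {K \<in> \<H>. \<exists>t\<in>A. P t K}"
  using openin_Collect_bex[of A X P] unfolding topspace_X .

text \<open>The complement of \<open>U\<close> is closed, invariant and proper, hence empty.\<close>

lemma minimal:
  assumes U: "openin X U" "U \<noteq> {}" and inv: "\<And>g K. g \<in> G \<Longrightarrow> K \<in> \<H> \<Longrightarrow> K \<notin> U \<Longrightarrow> conj g K \<notin> U"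
  shows "U = \<H>"
proof (rule ccontr)
  assume "U \<noteq> \<H>"
  have UH: "U \<subseteq> \<H>" using openin_subset[OF U(1)] by simp
  have "closedin X (\<H> - U)" using U(1) by (metis closedin_def double_diff openin_subset Diff_subset topspace_X order_refl)
  then have "closedin (chabauty G) (\<H> - U)" using URS_closed by (rule closedin_trans_full)
  moreover have "G_invariant_sub G (\<H> - U)"
    unfolding G_invariant_sub_def using inv URS_conj by blast
  moreover have "\<H> - U \<noteq> {}" using UH \<open>U \<noteq> \<H>\<close> by blast
  moreover have "\<forall>\<K>. \<K> \<noteq> {} \<and> \<K> \<subseteq> \<H> \<and> closedin (chabauty G) \<K> \<and> G_invariant_sub G \<K> \<longrightarrow> \<K> = \<H>"
    using urs by (simp add: is_URS_def)
  ultimately have "\<H> - U = \<H>" by (elim allE[of _ "\<H> - U"]) simp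
  then show False using UH U(2) by blast
qed

text \<open>The set where \<open>card (\<Phi> K)\<close> attains its maximum \<open>c\<close> is
  open and invariant, hence everything. So \<open>t \<notin> \<Phi> K\<close> holds exactly when
  \<open>\<Phi> K\<close> contains some \<open>c\<close>-element set avoiding \<open>t\<close>,
  which is open.\<close>

lemma closedin_of_finite_equivariant:
  fixes \<Phi> :: "autom set \<Rightarrow> 'b set"
  assumes fin: "finite D" and sub: "\<And>K. K \<in> \<H> \<Longrightarrow> \<Phi> K \<subseteq> D"
    and opn: "\<And>t. t \<in> D \<Longrightarrow> openin X {K \<in> \<H>. t \<in> \<Phi> K}"
    and card: "\<And>g K. g \<in> G \<Longrightarrow> K \<in> \<H> \<Longrightarrow> card (\<Phi> (conj g K)) \<le> card (\<Phi> K)"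
    and t: "t \<in> D"
  shows "closedin X {K \<in> \<H>. t \<in> \<Phi> K}"
proof -
  have finPhi: "finite (\<Phi> K)" if "K \<in> \<H>" for K using sub[OF that] fin finite_subset by blast
  \<comment> \<open>The reverse inequality is the assumption applied to \<open>inv g\<close> and
    \<open>conj g K\<close>.\<close>
  have card_eq: "card (\<Phi> (conj g K)) = card (\<Phi> K)" if "g \<in> G" "K \<in> \<H>" for g K
    using card[OF that] card[OF G_closed(3)[OF that(1)] URS_conj[OF that]] conj_conj_inv[OF G_bij[OF that(1)]] by simp
  define c where "c = Max (card ` \<Phi> ` \<H>)"
  have finC: "finite (card ` \<Phi> ` \<H>)"
  proof -
    have "card ` \<Phi> ` \<H> \<subseteq> {..card D}" using sub fin by (auto intro: card_mono)
    then show ?thesis by (rule finite_subset) simp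
  qed
  have le: "card (\<Phi> K) \<le> c" if "K \<in> \<H>" for K
    unfolding c_def using finC that by (intro Max_ge) auto
  have super: "openin X {K \<in> \<H>. A \<subseteq> \<Phi> K}" if "A \<subseteq> D" for A
  proof -
    have "openin X {K \<in> \<H>. \<forall>t\<in>A. t \<in> \<Phi> K}"
      by (rule openin_ball) (use that fin opn finite_subset in blast)+
    then show ?thesis by (simp add: subset_iff Ball_def)
  qed
  have max: "A = \<Phi> K" if "K \<in> \<H>" "card A = c" "A \<subseteq> \<Phi> K" for A K
    using card_seteq[OF finPhi[OF that(1)] that(3)] le[OF that(1)] that(2) by simp
  have all: "{K \<in> \<H>. card (\<Phi> K) = c} = \<H>"
  proof (rule minimal)
    have "{K \<in> \<H>. card (\<Phi> K) = c} = {K \<in> \<H>. \<exists>A\<in>{A. A \<subseteq> D \<and> card A = c}. A \<subseteq> \<Phi> K}"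
      using sub max by blast
    moreover have "openin X \<dots>" by (rule openin_bex) (use super in blast)
    ultimately show "openin X {K \<in> \<H>. card (\<Phi> K) = c}" by simp
    have "c \<in> card ` \<Phi> ` \<H>" unfolding c_def using finC URS_nonempty by (intro Max_in) auto
    then show "{K \<in> \<H>. card (\<Phi> K) = c} \<noteq> {}" by blast
  qed (use card_eq URS_conj in auto)
  have "{K \<in> \<H>. t \<notin> \<Phi> K} = {K \<in> \<H>. \<exists>A\<in>{A. A \<subseteq> D \<and> card A = c \<and> t \<notin> A}. A \<subseteq> \<Phi> K}"
    using all sub max by blast
  moreover have "openin X \<dots>" by (rule openin_bex) (use super in blast)
  ultimately have "openin X {K \<in> \<H>. t \<notin> \<Phi> K}" by simp
  moreover have "\<H> - {K \<in> \<H>. t \<in> \<Phi> K} = {K \<in> \<H>. t \<notin> \<Phi> K}" by blast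
  ultimately show ?thesis unfolding closedin_def topspace_X by auto
qed

lemma URS_recurrent:
  assumes H: "H \<in> \<H>" shows "recurrent H"
  unfolding recurrent_def
proof (intro allI impI)
  fix S n assume S: "finite S \<and> S \<subseteq> H"
  have SG: "S \<subseteq> G" using S URS_subgroup(2)[OF H] by blast
  let ?L = "lev m n"
  \<comment> \<open>Only the action on level \<open>n\<close> of the conjugating elements is kept,
    so that \<open>A K\<close> lies in a fixed finite set.\<close>
  define A where "A K = {restrict g ?L | g. g \<in> G \<and> (\<forall>s\<in>S. inv g \<circ> s \<circ> g \<in> K)}" for K
  have A_open: "openin X {K \<in> \<H>. \<forall>s\<in>S. inv g \<circ> s \<circ> g \<in> K}" if "g \<in> G" for g
    by (rule openin_ball) (use S SG that in \<open>auto intro!: openin_mem G_closed\<close>)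
  have finL: "finite (?L \<rightarrow>\<^sub>E ?L)" using finite_lev by (simp add: finite_PiE)
  have AL: "A K \<subseteq> ?L \<rightarrow>\<^sub>E ?L" for K
    using aut_lev[OF G_aut] by (auto simp: A_def)
  have "closedin X {K \<in> \<H>. restrict id ?L \<in> A K}"
  proof (rule closedin_of_finite_equivariant[OF finL AL])
    fix \<tau> assume "\<tau> \<in> ?L \<rightarrow>\<^sub>E ?L"
    have "{K \<in> \<H>. \<tau> \<in> A K} = {K \<in> \<H>. \<exists>g\<in>{g \<in> G. restrict g ?L = \<tau>}. \<forall>s\<in>S. inv g \<circ> s \<circ> g \<in> K}"
      by (auto simp: A_def)
    moreover have "openin X \<dots>" by (rule openin_bex) (use A_open in blast)
    ultimately show "openin X {K \<in> \<H>. \<tau> \<in> A K}" by simp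
  next
    fix t K assume t: "t \<in> G" and K: "K \<in> \<H>"
    \<comment> \<open>If \<open>g\<close> serves \<open>conj t K\<close>, then
      \<open>g \<circ> t\<close> serves \<open>K\<close>; composing with \<open>inv t\<close>
      recovers \<open>g\<close> on the level.\<close>
    have "A (conj t K) \<subseteq> (\<lambda>\<tau>. restrict (\<lambda>v. \<tau> (inv t v)) ?L) ` A K"
    proof
      fix \<tau> assume "\<tau> \<in> A (conj t K)"
      then obtain g where g: "\<tau> = restrict g ?L" "g \<in> G" "\<And>s. s \<in> S \<Longrightarrow> inv g \<circ> s \<circ> g \<in> conj t K"
        by (auto simp: A_def)
      have "inv (g \<circ> t) \<circ> s \<circ> (g \<circ> t) \<in> K" if "s \<in> S" for s
        using g(3)[OF that] G_bij[OF t] G_bij[OF g(2)] by (simp add: mem_conj_iff o_inv_distrib comp_assoc)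
      then have "restrict (g \<circ> t) ?L \<in> A K" using g(2) t G_closed by (auto simp: A_def)
      moreover have "\<tau> = restrict (\<lambda>v. restrict (g \<circ> t) ?L (inv t v)) ?L"
        unfolding g(1) using aut_lev[OF G_aut[OF G_closed(3)[OF t]]] bij_inv_cancel[OF G_bij[OF t]]
        by (intro restrict_ext) simp
      ultimately show "\<tau> \<in> (\<lambda>\<tau>. restrict (\<lambda>v. \<tau> (inv t v)) ?L) ` A K" by blast
    qed
    moreover have "finite (A K)" using AL finL finite_subset by blast
    ultimately show "card (A (conj t K)) \<le> card (A K)"
      by (meson card_image_le card_mono finite_imageI order_trans)
  qed auto
  then have "compactin X {K \<in> \<H>. restrict id ?L \<in> A K}"
    by (rule closedin_compact_space[OF compact_X])
  moreover define G0 where "G0 = {g \<in> G. \<forall>v\<in>?L. g v = v}"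
  let ?U = "\<lambda>g. {K \<in> \<H>. \<forall>s\<in>S. inv g \<circ> s \<circ> g \<in> K}"
  \<comment> \<open>On this compact set a witness can be taken in the pointwise stabilizer
    \<open>G0\<close> of the level, so finitely many suffice.\<close>
  have "{K \<in> \<H>. restrict id ?L \<in> A K} \<subseteq> \<Union>(?U ` G0)"
  proof
    fix K assume "K \<in> {K \<in> \<H>. restrict id ?L \<in> A K}"
    then obtain g where g: "K \<in> \<H>" "restrict id ?L = restrict g ?L" "g \<in> G" "\<forall>s\<in>S. inv g \<circ> s \<circ> g \<in> K"
      by (auto simp: A_def)
    have "g v = v" if "v \<in> ?L" for v using fun_cong[OF g(2), of v] that by simp
    with g show "K \<in> \<Union>(?U ` G0)" by (auto simp: G0_def)
  qed
  moreover have "openin X U" if "U \<in> ?U ` G0" for U using that A_open by (auto simp: G0_def)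
  ultimately obtain \<F> where \<F>: "finite \<F>" "\<F> \<subseteq> ?U ` G0" "{K \<in> \<H>. restrict id ?L \<in> A K} \<subseteq> \<Union>\<F>"
    using compactinD[of X "{K \<in> \<H>. restrict id ?L \<in> A K}" "?U ` G0"] by blast
  obtain \<Gamma> where \<Gamma>: "\<Gamma> \<subseteq> G0" "finite \<Gamma>" "\<F> = ?U ` \<Gamma>"
    using finite_subset_image[OF \<F>(1,2)] by blast
  have "\<exists>g\<in>\<Gamma>. \<forall>s\<in>S. inv \<gamma> \<circ> (inv g \<circ> s \<circ> g) \<circ> \<gamma> \<in> H" if \<gamma>: "\<gamma> \<in> G" "\<forall>v\<in>?L. \<gamma> v = v" for \<gamma>
  proof -
    have b: "bij \<gamma>" using G_bij[OF \<gamma>(1)] .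
    \<comment> \<open>\<open>conj \<gamma> H\<close> belongs to the compact set, with witness
      \<open>inv \<gamma>\<close>, which also fixes the level.\<close>
    have "inv (inv \<gamma>) \<circ> s \<circ> inv \<gamma> \<in> conj \<gamma> H" if "s \<in> S" for s
      using that S b unfolding conj_def by (auto simp: inv_inv_eq)
    moreover have "restrict (inv \<gamma>) ?L = restrict id ?L"
      using \<gamma>(2) bij_inv_cancel(1)[OF b] by (intro restrict_ext) (metis id_apply)
    ultimately have "restrict id ?L \<in> A (conj \<gamma> H)"
      unfolding A_def using G_closed(3)[OF \<gamma>(1)] by (intro CollectI exI[of _ "inv \<gamma>"]) simp
    then have "conj \<gamma> H \<in> \<Union>\<F>" using \<F>(3) URS_conj[OF \<gamma>(1) H] by blast
    then obtain g where "g \<in> \<Gamma>" "\<forall>s\<in>S. inv g \<circ> s \<circ> g \<in> conj \<gamma> H" using \<Gamma>(3) by blast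
    then show ?thesis using b by (auto simp: mem_conj_iff)
  qed
  then show "\<exists>\<Gamma>. finite \<Gamma> \<and> \<Gamma> \<subseteq> G \<and> (\<forall>g\<in>\<Gamma>. \<forall>v\<in>lev m n. g v = v)
     \<and> (\<forall>\<gamma>\<in>G. (\<forall>v\<in>lev m n. \<gamma> v = v) \<longrightarrow> (\<exists>g\<in>\<Gamma>. \<forall>s\<in>S. inv \<gamma> \<circ> (inv g \<circ> s \<circ> g) \<circ> \<gamma> \<in> H))"
    using \<Gamma>(1,2) by (intro exI[of _ \<Gamma>]) (auto simp: G0_def)
qed

end

subsection \<open>The Hausdorff topology and clopen conditions\<close>

text \<open>The vertices of level \<open>n\<close> missed by a set of rays are those outside its
  trace; the trace at level 0 tells only whether the set is empty.\<close>

definition level_trace :: "nat \<Rightarrow> ray set \<Rightarrow> vert set" where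
  "level_trace n F = (\<lambda>\<xi>. pre \<xi> n) ` F"

lemma trace_take: "k \<le> n \<Longrightarrow> level_trace k F = take k ` level_trace n F"
  by (simp add: level_trace_def image_image take_pre)

lemma trace_mono_eq: "level_trace n A = level_trace n B \<Longrightarrow> k \<le> n \<Longrightarrow> level_trace k A = level_trace k B"
  by (simp add: trace_take)

lemma trace_lev: "F \<subseteq> bd m \<Longrightarrow> level_trace n F \<subseteq> lev m n"
  by (auto simp: level_trace_def pre_lev)

section \<open>Traces and the Hausdorff distance\<close>

lemma bd_dist_nonneg: "0 \<le> bd_dist x y" and bd_dist_le_1: "bd_dist x y \<le> 1"
  by (auto simp: bd_dist_def power_le_one)

lemma bd_dist_le: assumes "pre x n = pre y n" shows "bd_dist x y \<le> (1/2) ^ n"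
proof (cases "x = y")
  case False
  then obtain i where "x i \<noteq> y i" by (auto simp: fun_eq_iff)
  then have "x (LEAST n. x n \<noteq> y n) \<noteq> y (LEAST n. x n \<noteq> y n)" by (rule LeastI)
  moreover have "x i = y i" if "i < n" for i using assms that by (simp add: pre_eq_iff)
  ultimately have "n \<le> (LEAST n. x n \<noteq> y n)" using linorder_not_less by blast
  with False show ?thesis by (simp add: bd_dist_def power_decreasing del: power_divide)
qed (simp add: bd_dist_def)

text \<open>The first difference has index at most \<open>n - 1\<close>, whence the factor 2 and the
  gap to the bound in \<open>bd_dist_le\<close>.\<close>

lemma bd_dist_ge: assumes "pre x n \<noteq> pre y n" shows "2 * (1/2) ^ n \<le> bd_dist x y"
proof -
  obtain i where i: "i < n" "x i \<noteq> y i" using assms by (auto simp: pre_eq_iff)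
  have "(LEAST n. x n \<noteq> y n) \<le> i" using i(2) by (rule Least_le)
  then have "Suc (LEAST n. x n \<noteq> y n) \<le> n" using i(1) by simp
  then have "(1/2::real) ^ n \<le> (1/2) ^ Suc (LEAST n. x n \<noteq> y n)" by (intro power_decreasing) auto
  moreover have "bd_dist x y = (1/2) ^ (LEAST n. x n \<noteq> y n)" using i(2) by (auto simp: bd_dist_def)
  ultimately show ?thesis by simp
qed

text \<open>Real suprema and infima obey the order laws only for nonempty bounded families; this
  explains the side conditions here and in \<open>SUP_INF_ge\<close>.\<close>

lemma SUP_INF_le:
  fixes d :: "'a \<Rightarrow> 'b \<Rightarrow> real"
  assumes "A \<noteq> {}" and d: "\<And>x y. 0 \<le> d x y" and "\<And>x. x \<in> A \<Longrightarrow> \<exists>y\<in>B. d x y \<le> c"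
  shows "(SUP x\<in>A. INF y\<in>B. d x y) \<le> c"
proof (rule cSUP_least[OF assms(1)])
  fix x assume "x \<in> A"
  then obtain y where y: "y \<in> B" "d x y \<le> c" using assms(3) by blast
  have "(INF y\<in>B. d x y) \<le> d x y" using y(1) d by (intro cINF_lower bdd_belowI2[where m=0])
  with y show "(INF y\<in>B. d x y) \<le> c" by simp
qed

lemma SUP_INF_ge:
  fixes d :: "'a \<Rightarrow> 'b \<Rightarrow> real"
  assumes x: "x \<in> A" and B: "B \<noteq> {}" and d: "\<And>x y. 0 \<le> d x y" "\<And>x y. d x y \<le> C"
    and c: "\<And>y. y \<in> B \<Longrightarrow> c \<le> d x y"
  shows "c \<le> (SUP x\<in>A. INF y\<in>B. d x y)"
proof -
  obtain y0 where y0: "y0 \<in> B" using B by blast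
  have "(INF y\<in>B. d z y) \<le> C" for z
  proof -
    have "(INF y\<in>B. d z y) \<le> d z y0" using y0 d(1) by (intro cINF_lower bdd_belowI2[where m=0])
    with d(2)[of z y0] show ?thesis by simp
  qed
  then have "(INF y\<in>B. d x y) \<le> (SUP x\<in>A. INF y\<in>B. d x y)"
    using x by (intro cSUP_upper bdd_aboveI2[where M=C])
  moreover have "c \<le> (INF y\<in>B. d x y)" using B c by (rule cINF_greatest)
  ultimately show ?thesis by simp
qed

lemma hdist_le: assumes "level_trace n A = level_trace n B" shows "hdist A B \<le> (1/2) ^ n"
proof (cases "A = {} \<or> B = {}")
  case True
  then have "A = {} \<and> B = {}" using assms by (auto simp: level_trace_def)
  then show ?thesis by (simp add: hdist_def)
next
  case False
  have "\<exists>y\<in>B. bd_dist x y \<le> (1/2) ^ n" if "x \<in> A" for x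
  proof -
    have "pre x n \<in> level_trace n B" using that assms by (auto simp: level_trace_def)
    then obtain y where "y \<in> B" "pre x n = pre y n" by (auto simp: level_trace_def)
    then show ?thesis using bd_dist_le by blast
  qed
  moreover have "\<exists>x\<in>A. bd_dist x y \<le> (1/2) ^ n" if "y \<in> B" for y
  proof -
    have "pre y n \<in> level_trace n A" using that assms by (auto simp: level_trace_def)
    then obtain x where "x \<in> A" "pre x n = pre y n" by (auto simp: level_trace_def)
    then show ?thesis using bd_dist_le by blast
  qed
  ultimately have "(SUP x\<in>A. INF y\<in>B. bd_dist x y) \<le> (1/2) ^ n" "(SUP y\<in>B. INF x\<in>A. bd_dist x y) \<le> (1/2) ^ n"
    using False bd_dist_nonneg by (intro SUP_INF_le; blast)+
  then show ?thesis using False by (auto simp: hdist_def)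
qed

lemma hdist_ge: assumes "level_trace n A \<noteq> level_trace n B" shows "2 * (1/2) ^ n \<le> hdist A B"
proof (cases "A = {} \<or> B = {}")
  case True
  \<comment> \<open>Exactly one of the sets is empty, and the distance 2 assigned then is large
    enough for every \<open>n\<close>.\<close>
  moreover have "\<not> (A = {} \<and> B = {})" using assms by auto
  ultimately have "hdist A B = 2" by (auto simp: hdist_def)
  moreover have "(1/2::real) ^ n \<le> 1" by (intro power_le_one) auto
  ultimately show ?thesis by simp
next
  case False
  consider x where "x \<in> A" "pre x n \<notin> level_trace n B" | y where "y \<in> B" "pre y n \<notin> level_trace n A"
    using assms by (auto simp: level_trace_def set_eq_iff)
  then have "2 * (1/2) ^ n \<le> (SUP x\<in>A. INF y\<in>B. bd_dist x y) \<or> 2 * (1/2) ^ n \<le> (SUP y\<in>B. INF x\<in>A. bd_dist x y)"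
  proof cases
    case 1
    then have "2 * (1/2) ^ n \<le> bd_dist x y" if "y \<in> B" for y
      using that by (intro bd_dist_ge) (auto simp: level_trace_def)
    then have "2 * (1/2) ^ n \<le> (SUP x\<in>A. INF y\<in>B. bd_dist x y)"
      using SUP_INF_ge[of x A B bd_dist 1] 1 False bd_dist_nonneg bd_dist_le_1 by auto
    then show ?thesis ..
  next
    case 2
    then have "2 * (1/2) ^ n \<le> bd_dist x y" if "x \<in> A" for x
      using that by (intro bd_dist_ge notI) (metis imageI level_trace_def)
    then have "2 * (1/2) ^ n \<le> (SUP y\<in>B. INF x\<in>A. bd_dist x y)"
      using SUP_INF_ge[of y B A "\<lambda>y x. bd_dist x y" 1] 2 False bd_dist_nonneg bd_dist_le_1 by auto
    then show ?thesis ..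
  qed
  then show ?thesis using False by (auto simp: hdist_def)
qed

lemma hdist_le_2: "hdist A B \<le> 2"
proof (cases "level_trace 0 A = level_trace 0 B")
  case True
  then show ?thesis using hdist_le[OF True] by simp
next
  case False
  then have "A = {} \<or> B = {}" by (auto simp: level_trace_def pre_def)
  then show ?thesis by (auto simp: hdist_def)
qed

text \<open>No distance lies strictly between \<open>(1/2) ^ n\<close> and its double, so all radii
  in this window give the same ball.\<close>

lemma hdist_less_iff:
  assumes "(1/2) ^ n < e" "e \<le> 2 * (1/2) ^ n"
  shows "hdist A B < e \<longleftrightarrow> level_trace n A = level_trace n B"
  using hdist_le[of n A B] hdist_ge[of n A B] assms by fastforce

text \<open>The windows of \<open>hdist_less_iff\<close> exhaust the radii up to 2; by
  \<open>hdist_le_2\<close> a larger ball contains everything.\<close>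

lemma radius_level:
  fixes e :: real assumes "0 < e" "e \<le> 2"
  shows "\<exists>n. (1/2) ^ n < e \<and> e \<le> 2 * (1/2) ^ n"
proof -
  define n where "n = (LEAST n. (1/2::real) ^ n < e)"
  have "\<exists>n. (1/2::real) ^ n < e" using assms(1) by (intro real_arch_pow_inv) auto
  then have "(1/2) ^ n < e" unfolding n_def by (rule LeastI_ex)
  moreover have "e \<le> 2 * (1/2) ^ n"
  proof (cases n)
    case (Suc k)
    then have "\<not> (1/2) ^ k < e" using not_less_Least[of k "\<lambda>n. (1/2::real) ^ n < e"] by (simp add: n_def)
    then show ?thesis by (simp add: Suc)
  qed (use assms in simp)
  ultimately show ?thesis by blast
qed

lemma topspace_hausdorff: "topspace (hausdorff_top m) = closed_sets m"
proof -
  have "hdist A A < 2" for A using hdist_le[of 0 A A] by simp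
  then have "A \<in> {B \<in> closed_sets m. hdist A B < 2}" if "A \<in> closed_sets m" for A using that by simp
  then show ?thesis unfolding hausdorff_top_def topology_generated_by_topspace
    using zero_less_numeral by blast
qed

lemma openin_hausdorff_trace:
  assumes "A \<in> closed_sets m"
  shows "openin (hausdorff_top m) {B \<in> closed_sets m. level_trace n A = level_trace n B}"
proof -
  have "{B \<in> closed_sets m. level_trace n A = level_trace n B} = {B \<in> closed_sets m. hdist A B < 2 * (1/2) ^ n}"
    by (simp add: hdist_less_iff[of n])
  then show ?thesis unfolding hausdorff_top_def
    by (intro topology_generated_by_Basis) (use assms in \<open>auto intro!: exI[of _ A] exI[of _ "2 * (1/2) ^ n"]\<close>)
qed

lemma topspace_bd: "topspace (bd_top m) = bd m"
proof -
  have "cyl m [] = bd m" by (auto simp: cyl_def)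
  moreover have "[] \<in> verts m" by (simp add: verts_def)
  moreover have "cyl m v \<subseteq> bd m" for v by (auto simp: cyl_def)
  ultimately show ?thesis unfolding bd_top_def topology_generated_by_topspace by blast
qed

lemma closed_sets_bd: "F \<in> closed_sets m \<Longrightarrow> F \<subseteq> bd m"
  unfolding closed_sets_def using closedin_subset topspace_bd by fastforce

lemma Fix_bd: "Fix m K \<subseteq> bd m"
  by (auto simp: Fix_def)

text \<open>Testing commutators one at a time makes failure a union of conditions that a given
  element is not in \<open>K\<close>.\<close>

definition has_comms :: "(nat \<Rightarrow> nat) \<Rightarrow> autom set \<Rightarrow> autom set \<Rightarrow> vert \<Rightarrow> bool" where
  "has_comms m G K w \<longleftrightarrow> (\<forall>(a, b) \<in> rist m G w \<times> rist m G w. a \<circ> b \<circ> inv a \<circ> inv b \<in> K)"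

lemma has_comms_iff: assumes "is_subgroup K" shows "has_comms m G K w \<longleftrightarrow> derived (rist m G w) \<subseteq> K"
proof
  assume "has_comms m G K w"
  then show "derived (rist m G w) \<subseteq> K"
    unfolding derived_def by (intro gen_subgroup_least assms) (auto simp: has_comms_def)
next
  assume "derived (rist m G w) \<subseteq> K"
  then show "has_comms m G K w"
    unfolding derived_def has_comms_def
    using gen_subgroup_incl[of "{a \<circ> b \<circ> inv a \<circ> inv b |a b. a \<in> rist m G w \<and> b \<in> rist m G w}"] by blast
qed

section \<open>Fixed point sets and their traces\<close>

context weakly_branch_group
begin

lemma has_comms_mono: "has_comms m G K u \<Longrightarrow> prefix u w \<Longrightarrow> has_comms m G K w"
  using rist_mono unfolding has_comms_def by blast

lemma Fix_iff_G: "K \<subseteq> G \<Longrightarrow> \<xi> \<in> Fix m K \<longleftrightarrow> \<xi> \<in> bd m \<and> (\<forall>h\<in>K. \<forall>n. h (pre \<xi> n) = pre \<xi> n)"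
  using Fix_iff[of K m \<xi>] G_aut by blast

text \<open>A vertex moved by \<open>K\<close> is a prefix of no fixed ray.\<close>

lemma not_Fix_trace:
  assumes "K \<subseteq> G" "\<xi> \<in> bd m" "\<xi> \<notin> Fix m K" shows "\<exists>n. pre \<xi> n \<notin> level_trace n (Fix m K)"
proof -
  obtain h n where h: "h \<in> K" "h (pre \<xi> n) \<noteq> pre \<xi> n" using assms Fix_iff_G by blast
  have "pre \<xi> n \<notin> level_trace n (Fix m K)"
  proof
    assume "pre \<xi> n \<in> level_trace n (Fix m K)"
    then obtain \<eta> where "\<eta> \<in> Fix m K" "pre \<xi> n = pre \<eta> n" by (auto simp: level_trace_def)
    then show False using h Fix_iff_G[OF assms(1)] by metis
  qed
  then show ?thesis ..
qed

lemma Fix_closed: assumes "K \<subseteq> G" shows "Fix m K \<in> closed_sets m"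
proof -
  let ?V = "{v \<in> verts m. v \<notin> level_trace (length v) (Fix m K)}"
  have "bd m - Fix m K = \<Union>(cyl m ` ?V)"
  proof (intro equalityI subsetI)
    fix \<xi> assume \<xi>: "\<xi> \<in> bd m - Fix m K"
    then obtain n where n: "pre \<xi> n \<notin> level_trace n (Fix m K)" using not_Fix_trace[OF assms] by blast
    then have "pre \<xi> n \<in> ?V" using \<xi> by (simp add: pre_verts)
    moreover have "\<xi> \<in> cyl m (pre \<xi> n)" using \<xi> by (simp add: cyl_iff)
    ultimately show "\<xi> \<in> \<Union>(cyl m ` ?V)" by blast
  qed (force simp: cyl_iff level_trace_def)
  moreover have "openin (bd_top m) (\<Union>(cyl m ` ?V))"
    unfolding bd_top_def by (intro openin_Union) (auto intro!: topology_generated_by_Basis)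
  ultimately show ?thesis
    unfolding closed_sets_def closedin_def topspace_bd using Fix_bd by auto
qed

text \<open>Koenig's lemma replaces a fixed ray through \<open>v\<close> by fixed vertices on all
  deeper levels. In this form, absence of \<open>v\<close> from the trace is witnessed at one level
  by finitely many elements of \<open>K\<close>.\<close>

lemma trace_Fix_iff:
  assumes K: "K \<subseteq> G" and v: "v \<in> lev m n"
  shows "v \<in> level_trace n (Fix m K) \<longleftrightarrow> (\<forall>N\<ge>n. \<exists>w\<in>lev m N. prefix v w \<and> (\<forall>h\<in>K. h w = w))"
proof
  assume "v \<in> level_trace n (Fix m K)"
  then obtain \<xi> where \<xi>: "\<xi> \<in> Fix m K" "v = pre \<xi> n" by (auto simp: level_trace_def)
  show "\<forall>N\<ge>n. \<exists>w\<in>lev m N. prefix v w \<and> (\<forall>h\<in>K. h w = w)"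
  proof (intro allI impI)
    show "\<exists>w\<in>lev m N. prefix v w \<and> (\<forall>h\<in>K. h w = w)" if "n \<le> N" for N
      by (rule bexI[of _ "pre \<xi> N"]) (use \<xi> that Fix_iff_G[OF K] in \<open>auto simp: pre_prefix pre_lev\<close>)
  qed
next
  assume R: "\<forall>N\<ge>n. \<exists>w\<in>lev m N. prefix v w \<and> (\<forall>h\<in>K. h w = w)"
  have vl: "v \<in> verts m" "length v = n" using v by (auto simp: lev_def)
  let ?P = "\<lambda>w. w \<in> verts m \<and> (\<forall>h\<in>K. h w = w)"
  have down: "?P x" if "?P y" "prefix x y" for x y
  proof -
    have "x = take (length x) y" using that(2) by (simp add: prefix_take_iff)
    then have "h x = x" if "h \<in> K" for h
      using aut_take[OF G_aut, of h y "length x"] that(1) \<open>?P y\<close> K by (metis subsetD)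
    then show ?thesis using that prefix_verts by blast
  qed
  have "\<exists>\<xi>\<in>cyl m v. \<forall>k\<ge>length v. ?P (pre \<xi> k)"
  proof (rule koenig[OF vl(1)])
    show "\<exists>w\<in>lev m N. prefix v w \<and> ?P w" if "length v \<le> N" for N
      using R that vl(2) by (auto simp: lev_def)
  qed (use down in blast)
  then obtain \<xi> where \<xi>: "\<xi> \<in> cyl m v" "\<And>k. k \<ge> n \<Longrightarrow> ?P (pre \<xi> k)" using vl(2) by blast
  \<comment> \<open>Koenig's lemma covers lengths from \<open>n\<close> on; a shorter prefix is
    fixed because a longer one is.\<close>
  have "?P (pre \<xi> k)" for k
    using down[OF \<xi>(2)[of "max k n"] pre_prefix[of k "max k n" \<xi>]] by simp
  then have "\<xi> \<in> Fix m K" using \<xi>(1) by (simp add: Fix_iff_G[OF K] cyl_iff)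
  moreover have "v = pre \<xi> n" using \<xi>(1) vl(2) by (simp add: cyl_iff)
  ultimately show "v \<in> level_trace n (Fix m K)" unfolding level_trace_def by blast
qed

lemma trace_act:
  assumes g: "g \<in> G" and F: "F \<subseteq> bd m" shows "level_trace n (act_bd g ` F) = g ` level_trace n F"
  unfolding level_trace_def image_image using F by (intro image_cong refl pre_act[OF G_aut[OF g]]) auto

lemma act_Fix_conj:
  assumes g: "g \<in> G" and K: "K \<subseteq> G" and \<xi>: "\<xi> \<in> Fix m K" shows "act_bd g \<xi> \<in> Fix m (conj g K)"
proof -
  have cG: "conj g K \<subseteq> G" using g K G_closed by (auto simp: conj_def)
  have \<xi>': "\<xi> \<in> bd m" "\<And>h n. h \<in> K \<Longrightarrow> h (pre \<xi> n) = pre \<xi> n" using \<xi> Fix_iff_G[OF K] by auto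
  have "k (g (pre \<xi> n)) = g (pre \<xi> n)" if k: "k \<in> conj g K" for k n
  proof -
    obtain h where "h \<in> K" "k = g \<circ> h \<circ> inv g" using k by (auto simp: conj_def)
    then show ?thesis using \<xi>'(2)[of h n] bij_inv_cancel(1)[OF G_bij[OF g]] by simp
  qed
  then show ?thesis
    by (simp add: Fix_iff_G[OF cG] pre_act[OF G_aut[OF g] \<xi>'(1)] act_bd_in[OF G_aut[OF g] \<xi>'(1)])
qed

end

section \<open>Clopen conditions on a uniformly recurrent subgroup\<close>

context weakly_branch_URS
begin

lemma openin_not_of_closedin:
  assumes "closedin X {K \<in> \<H>. P K}" shows "openin X {K \<in> \<H>. \<not> P K}"
proof -
  have "openin X (\<H> - {K \<in> \<H>. P K})" using assms unfolding closedin_def topspace_X by blast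
  moreover have "\<H> - {K \<in> \<H>. P K} = {K \<in> \<H>. \<not> P K}" by blast
  ultimately show ?thesis by simp
qed

lemma openin_not_trace:
  assumes v: "v \<in> lev m n" shows "openin X {K \<in> \<H>. v \<notin> level_trace n (Fix m K)}"
proof -
  have "v \<notin> level_trace n (Fix m K) \<longleftrightarrow> (\<exists>N\<in>{n..}. \<forall>w\<in>{w \<in> lev m N. prefix v w}. \<exists>h\<in>{h \<in> G. h w \<noteq> w}. h \<in> K)"
    if K: "K \<in> \<H>" for K
  proof -
    have "(\<exists>h\<in>{h \<in> G. h w \<noteq> w}. h \<in> K) \<longleftrightarrow> (\<exists>h\<in>K. h w \<noteq> w)" for w
      using URS_subgroup(2)[OF K] by blast
    then show ?thesis
      unfolding trace_Fix_iff[OF URS_subgroup(2)[OF K] v]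
      by (simp only: atLeast_iff mem_Collect_eq Bex_def Ball_def) blast
  qed
  then have "{K \<in> \<H>. v \<notin> level_trace n (Fix m K)}
      = {K \<in> \<H>. \<exists>N\<in>{n..}. \<forall>w\<in>{w \<in> lev m N. prefix v w}. \<exists>h\<in>{h \<in> G. h w \<noteq> w}. h \<in> K}"
    by (intro Collect_cong conj_cong refl)
  also have "openin X \<dots>"
    by (intro openin_bex openin_ball) (auto simp: finite_lev intro!: openin_mem)
  finally show ?thesis .
qed

text \<open>The cardinality principle for the missed vertices of level \<open>n\<close>: being
  missed is open, hence closed.\<close>

lemma openin_trace:
  assumes v: "v \<in> lev m n" shows "openin X {K \<in> \<H>. v \<in> level_trace n (Fix m K)}"
proof -
  let ?\<Phi> = "\<lambda>K. lev m n - level_trace n (Fix m K)"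
  have "closedin X {K \<in> \<H>. v \<in> ?\<Phi> K}"
  proof (rule closedin_of_finite_equivariant[OF finite_lev _ _ _ v])
    show "openin X {K \<in> \<H>. t \<in> ?\<Phi> K}" if "t \<in> lev m n" for t
      using openin_not_trace[OF that] that by simp
    fix g K assume gK: "g \<in> G" "K \<in> \<H>"
    have "?\<Phi> (conj g K) \<subseteq> g ` ?\<Phi> K"
    proof
      fix w assume w: "w \<in> ?\<Phi> (conj g K)"
      have gw: "g (inv g w) = w" using bij_inv_cancel(2)[OF G_bij[OF gK(1)]] .
      have "inv g w \<notin> level_trace n (Fix m K)"
      proof
        assume "inv g w \<in> level_trace n (Fix m K)"
        then obtain \<xi> where \<xi>: "\<xi> \<in> Fix m K" "inv g w = pre \<xi> n" by (auto simp: level_trace_def)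
        then have "pre (act_bd g \<xi>) n = w"
          using pre_act[OF G_aut[OF gK(1)]] Fix_bd gw by (metis subsetD)
        then show False
          using w act_Fix_conj[OF gK(1) URS_subgroup(2)[OF gK(2)] \<xi>(1)] by (auto simp: level_trace_def)
      qed
      moreover have "inv g w \<in> lev m n" using w aut_lev[OF G_aut[OF gK(1)], of "inv g w"] gw by simp
      ultimately show "w \<in> g ` ?\<Phi> K" using gw by (metis Diff_iff imageI)
    qed
    then show "card (?\<Phi> (conj g K)) \<le> card (?\<Phi> K)"
      by (rule surj_card_le[rotated]) (simp add: finite_lev)
  qed auto
  from openin_not_of_closedin[OF this] show ?thesis using v by simp
qed

text \<open>Failure is open, since a single commutator outside \<open>K\<close> witnesses it; the
  cardinality principle makes it closed as well.\<close>

lemma openin_has_comms: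
  assumes w: "w \<in> lev m n" shows "openin X {K \<in> \<H>. has_comms m G K w}"
proof -
  let ?\<Phi> = "\<lambda>K. {w \<in> lev m n. \<not> has_comms m G K w}"
  have "closedin X {K \<in> \<H>. w \<in> ?\<Phi> K}"
  proof (rule closedin_of_finite_equivariant[OF finite_lev _ _ _ w])
    fix t assume t: "t \<in> lev m n"
    have "{K \<in> \<H>. t \<in> ?\<Phi> K} = {K \<in> \<H>. \<exists>p\<in>rist m G t \<times> rist m G t. fst p \<circ> snd p \<circ> inv (fst p) \<circ> inv (snd p) \<notin> K}"
      using t by (auto simp: has_comms_def)
    also have "openin X \<dots>"
      by (intro openin_bex openin_mem G_closed) (auto dest: rist_G)
    finally show "openin X {K \<in> \<H>. t \<in> ?\<Phi> K}" .
  next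
    fix g K assume gK: "g \<in> G" "K \<in> \<H>"
    have b: "bij g" using G_bij[OF gK(1)] .
    have "?\<Phi> (conj g K) \<subseteq> g ` ?\<Phi> K"
    proof
      fix w assume "w \<in> ?\<Phi> (conj g K)"
      then obtain a b' where w: "w \<in> lev m n" "a \<in> rist m G w" "b' \<in> rist m G w" "a \<circ> b' \<circ> inv a \<circ> inv b' \<notin> conj g K"
        by (auto simp: has_comms_def)
      have gw: "g (inv g w) = w" using bij_inv_cancel(2)[OF b] .
      have wl: "inv g w \<in> lev m n" using w aut_lev[OF G_aut[OF gK(1)], of "inv g w"] gw by simp
      let ?c = "\<lambda>a. inv g \<circ> a \<circ> inv (inv g)"
      have r: "?c a \<in> rist m G (inv g w)" "?c b' \<in> rist m G (inv g w)"
        using w by (auto intro!: rist_conj G_closed gK simp: lev_def)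
      have ab: "bij a" "bij b'" using w G_bij rist_G by blast+
      \<comment> \<open>Conjugation by \<open>inv g\<close> carries a failing pair at
        \<open>w\<close> for \<open>conj g K\<close> to a failing pair at \<open>inv g w\<close> for
        \<open>K\<close>.\<close>
      have "?c a \<circ> ?c b' \<circ> inv (?c a) \<circ> inv (?c b') = inv g \<circ> (a \<circ> b' \<circ> inv a \<circ> inv b') \<circ> g"
        using b ab by (simp add: autom_group_simps)
      then have "?c a \<circ> ?c b' \<circ> inv (?c a) \<circ> inv (?c b') \<notin> K"
        using w(4) by (simp add: mem_conj_iff[OF b])
      then have "\<not> has_comms m G K (inv g w)" using r unfolding has_comms_def by blast
      then show "w \<in> g ` ?\<Phi> K" using wl gw by (metis (mono_tags, lifting) imageI mem_Collect_eq)
    qed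
    then show "card (?\<Phi> (conj g K)) \<le> card (?\<Phi> K)"
      by (rule surj_card_le[rotated]) (simp add: finite_lev)
  qed auto
  from openin_not_of_closedin[OF this] show ?thesis using w by simp
qed

lemma Fix_continuous: "continuous_map X (hausdorff_top m) (Fix m)"
  unfolding hausdorff_top_def continuous_on_generated_topo_iff
proof (intro conjI allI impI)
  fix U assume "U \<in> {{B \<in> closed_sets m. hdist A B < e} |A e. A \<in> closed_sets m \<and> 0 < e}"
  then obtain A e where A: "U = {B \<in> closed_sets m. hdist A B < e}" "A \<in> closed_sets m" "0 < e" by blast
  have eq: "Fix m -` U \<inter> topspace X = {K \<in> \<H>. hdist A (Fix m K) < e}"
    unfolding topspace_X A(1) using Fix_closed URS_subgroup(2) by blast
  show "openin X (Fix m -` U \<inter> topspace X)"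
  proof (cases "e \<le> 2")
    case False
    then have "hdist A B < e" for B using hdist_le_2[of A B] by linarith
    then have "{K \<in> \<H>. hdist A (Fix m K) < e} = \<H>" by simp
    then show ?thesis using eq openin_topspace[of X] unfolding topspace_X by simp
  next
    case True
    then obtain n where n: "(1/2) ^ n < e" "e \<le> 2 * (1/2) ^ n" using radius_level[OF A(3)] by blast
    \<comment> \<open>A ball is a finite conjunction of trace conditions on one level, each of them
      clopen.\<close>
    have "{K \<in> \<H>. hdist A (Fix m K) < e} = {K \<in> \<H>. \<forall>v\<in>lev m n. v \<in> level_trace n (Fix m K) \<longleftrightarrow> v \<in> level_trace n A}"
      unfolding hdist_less_iff[OF n]
      using trace_lev[OF closed_sets_bd[OF A(2)]] trace_lev[OF Fix_bd] by blast
    also have "openin X \<dots>"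
    proof (rule openin_ball[OF finite_lev])
      show "openin X {K \<in> \<H>. v \<in> level_trace n (Fix m K) \<longleftrightarrow> v \<in> level_trace n A}" if "v \<in> lev m n" for v
        using openin_trace[OF that] openin_not_trace[OF that] by (cases "v \<in> level_trace n A") auto
    qed
    finally show ?thesis using eq by simp
  qed
next
  have "Fix m K \<in> topspace (hausdorff_top m)" if "K \<in> \<H>" for K
    using Fix_closed URS_subgroup(2)[OF that] topspace_hausdorff by blast
  then show "Fix m ` topspace X \<subseteq> \<Union>{{B \<in> closed_sets m. hdist A B < e} |A e. A \<in> closed_sets m \<and> 0 < e}"
    unfolding topspace_X hausdorff_top_def topology_generated_by_topspace by blast
qed

text \<open>For a single \<open>K\<close>, failure at all levels would by Koenig's lemma produce a
  ray outside \<open>Fix m K\<close> none of whose long prefixes has the commutator property,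
  against \<open>rist_derived_subset\<close>. As the conditions are open, compactness yields a
  common level.\<close>

lemma uniform_level:
  "\<exists>N\<ge>n. \<forall>K\<in>\<H>. \<forall>w\<in>lev m N. take n w \<in> level_trace n (Fix m K) \<or> has_comms m G K w"
proof -
  let ?W = "\<lambda>N. {K \<in> \<H>. \<forall>w\<in>lev m N. take n w \<in> level_trace n (Fix m K) \<or> has_comms m G K w}"
  have opn: "openin X (?W N)" if "n \<le> N" for N
  proof (rule openin_ball[OF finite_lev])
    fix w assume w: "w \<in> lev m N"
    have "take n w \<in> lev m n" using w that by (auto simp: lev_def intro: prefix_verts[OF take_is_prefix])
    then have "openin X ({K \<in> \<H>. take n w \<in> level_trace n (Fix m K)} \<union> {K \<in> \<H>. has_comms m G K w})"
      using openin_trace openin_has_comms[OF w] by blast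
    moreover have "{K \<in> \<H>. take n w \<in> level_trace n (Fix m K)} \<union> {K \<in> \<H>. has_comms m G K w}
        = {K \<in> \<H>. take n w \<in> level_trace n (Fix m K) \<or> has_comms m G K w}" by blast
    ultimately show "openin X {K \<in> \<H>. take n w \<in> level_trace n (Fix m K) \<or> has_comms m G K w}" by simp
  qed
  have "\<exists>N\<ge>n. K \<in> ?W N" if K: "K \<in> \<H>" for K
  proof (rule ccontr)
    assume no: "\<not> ?thesis"
    note KG = URS_subgroup[OF K]
    \<comment> \<open>Vertices shorter than \<open>n\<close> satisfy \<open>?P\<close> vacuously; on
      longer ones it passes to prefixes because \<open>has_comms\<close> passes downwards.\<close>
    let ?P = "\<lambda>w. n \<le> length w \<longrightarrow> take n w \<notin> level_trace n (Fix m K) \<and> \<not> has_comms m G K w"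
    have "\<exists>\<xi>\<in>cyl m []. \<forall>k\<ge>length ([] :: vert). ?P (pre \<xi> k)"
    proof (rule koenig[where P="?P"])
      show "[] \<in> verts m" by (simp add: verts_def)
      show "?P x" if "?P y" "prefix x y" for x y
      proof
        assume "n \<le> length x"
        moreover have "take n x = take n y" using that(2) \<open>n \<le> length x\<close> by (auto simp: prefix_def)
        moreover have "length x \<le> length y" using that(2) by (rule prefix_length_le)
        ultimately show "take n x \<notin> level_trace n (Fix m K) \<and> \<not> has_comms m G K x"
          using that has_comms_mono by auto
      qed
      show "\<exists>w\<in>lev m N. prefix [] w \<and> ?P w" for N
      proof (cases "n \<le> N")
        case True
        then show ?thesis using no K by auto
      next
        case False
        obtain \<xi> where "\<xi> \<in> bd m"
          using wb unfolding weakly_branch_def bd_def by (auto intro: that[of "\<lambda>_. 0"])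
        then show ?thesis using False by (intro bexI[OF _ pre_lev]) auto
      qed
    qed
    then obtain \<xi> where \<xi>: "\<xi> \<in> bd m" "\<And>k. ?P (pre \<xi> k)" by (auto simp: cyl_iff)
    have "\<xi> \<notin> Fix m K" using \<xi>(2)[of n] by (auto simp: level_trace_def)
    then obtain k where "derived (rist m G (pre \<xi> k)) \<subseteq> K"
      using rist_derived_subset[OF URS_recurrent[OF K] KG \<xi>(1)] by blast
    then have "has_comms m G K (pre \<xi> k)" by (simp add: has_comms_iff[OF KG(1)])
    then have "has_comms m G K (pre \<xi> (max k n))" by (rule has_comms_mono) (simp add: pre_prefix)
    then show False using \<xi>(2)[of "max k n"] by simp
  qed
  then have cover: "\<H> \<subseteq> \<Union>(?W ` {n..})" by blast
  have "\<exists>\<F>. finite \<F> \<and> \<F> \<subseteq> ?W ` {n..} \<and> \<H> \<subseteq> \<Union>\<F>"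
  proof (rule compactinD[OF compact_X[unfolded compact_space_def topspace_X] _ cover])
    show "openin X U" if "U \<in> ?W ` {n..}" for U using that opn by blast
  qed
  then obtain \<F> where \<F>: "finite \<F>" "\<F> \<subseteq> ?W ` {n..}" "\<H> \<subseteq> \<Union>\<F>"
    by (elim exE conjE)
  obtain I where I: "I \<subseteq> {n..}" "finite I" "\<F> = ?W ` I"
    using finite_subset_image[OF \<F>(1,2)] by blast
  \<comment> \<open>Inserting \<open>n\<close> gives \<open>n \<le> N\<close> at once; what holds at
    a level \<open>i \<in> I\<close> persists at the deeper level \<open>N\<close>.\<close>
  define N where "N = Max (insert n I)"
  have leN: "i \<le> N" if "i \<in> insert n I" for i using that I(2) unfolding N_def by (intro Max_ge) auto
  have "take n w \<in> level_trace n (Fix m K) \<or> has_comms m G K w" if K: "K \<in> \<H>" and w: "w \<in> lev m N" for K w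
  proof -
    obtain i where i: "i \<in> I" "K \<in> ?W i" using K \<F>(3) I(3) by blast
    have "i \<le> N" "n \<le> i" using leN i(1) I(1) by auto
    then have "take i w \<in> lev m i" "take n (take i w) = take n w"
      using w by (auto simp: lev_def min_def intro: prefix_verts[OF take_is_prefix])
    then show ?thesis using i(2) has_comms_mono[OF _ take_is_prefix[of i w]] by force
  qed
  then show ?thesis using leN by blast
qed

end

subsection \<open>The equivariant section\<close>

text \<open>The index \<open>n\<close> is the first level at which \<open>w\<close> leaves the trace
  of \<open>F\<close>, hence unique; \<open>N\<close> will come from
  \<open>uniform_level\<close>.\<close>

definition section_of :: "(nat \<Rightarrow> nat) \<Rightarrow> (nat \<Rightarrow> nat) \<Rightarrow> ray set \<Rightarrow> vert set" where
  "section_of m N F = {w \<in> verts m. \<exists>n. length w = N n \<and> take n w \<notin> level_trace n F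
     \<and> (\<forall>j<n. take j w \<in> level_trace j F)}"

text \<open>Since \<open>n \<le> N n = length w\<close>, every trace consulted is determined by the
  one at level \<open>length w\<close>. This is the source of continuity.\<close>

lemma section_of_cong:
  assumes "\<And>n. n \<le> N n" and tr: "level_trace (length w) F = level_trace (length w) F'"
  shows "w \<in> section_of m N F \<longleftrightarrow> w \<in> section_of m N F'"
proof -
  have "level_trace j F = level_trace j F'" if "j \<le> n" "length w = N n" for j n
    using assms(1)[of n] that by (intro trace_mono_eq[OF tr]) simp
  then show ?thesis unfolding section_of_def by (auto; metis less_imp_le order_refl)
qed

text \<open>Comparable members have the same first missed prefix, hence the same \<open>n\<close>
  and the same length \<open>N n\<close>.\<close>

lemma section_of_Pi:
  assumes N: "\<And>n. n \<le> N n" shows "section_of m N F \<in> Pi_T m"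
proof -
  have "v = w" if v: "v \<in> section_of m N F" and w: "w \<in> section_of m N F" and p: "prefix v w" for v w
  proof -
    obtain n where n: "length v = N n" "take n v \<notin> level_trace n F" "\<And>j. j < n \<Longrightarrow> take j v \<in> level_trace j F"
      using v by (auto simp: section_of_def)
    obtain k where k: "length w = N k" "take k w \<notin> level_trace k F" "\<And>j. j < k \<Longrightarrow> take j w \<in> level_trace j F"
      using w by (auto simp: section_of_def)
    have tk: "take j v = take j w" if "j \<le> n" for j
      using p n(1) N[of n] that by (auto simp: prefix_def)
    have "n = k"
    proof (rule antisym)
      show "n \<le> k" using n(3)[of k] k(2) tk[of k] by (metis leI less_imp_le)
      show "k \<le> n" using k(3)[of n] n(2) tk[of n] by (metis leI order_refl)
    qed
    then show ?thesis using p n(1) k(1) by (simp add: prefix_take_iff)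
  qed
  then show ?thesis by (auto simp: Pi_T_def indep_def section_of_def)
qed

context weakly_branch_group
begin

lemma pi_perp_section_of:
  assumes N: "\<And>n. n \<le> N n" and K: "K \<subseteq> G" shows "pi_perp m (section_of m N (Fix m K)) = Fix m K"
proof (intro equalityI subsetI)
  fix \<xi> assume "\<xi> \<in> pi_perp m (section_of m N (Fix m K))"
  then have \<xi>: "\<xi> \<in> bd m" "\<And>w. w \<in> section_of m N (Fix m K) \<Longrightarrow> \<xi> \<notin> cyl m w" by (auto simp: pi_perp_def)
  show "\<xi> \<in> Fix m K"
  proof (rule ccontr)
    assume "\<xi> \<notin> Fix m K"
    then have ex: "\<exists>n. pre \<xi> n \<notin> level_trace n (Fix m K)" using not_Fix_trace[OF K \<xi>(1)] by blast
    \<comment> \<open>The first level at which \<open>\<xi>\<close> leaves the trace; the prefix of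
      length \<open>N n\<close> is then in the section.\<close>
    define n where "n = (LEAST n. pre \<xi> n \<notin> level_trace n (Fix m K))"
    have n: "pre \<xi> n \<notin> level_trace n (Fix m K)" unfolding n_def using ex by (rule LeastI_ex)
    have "pre \<xi> j \<in> level_trace j (Fix m K)" if "j < n" for j
      using not_less_Least[of j "\<lambda>n. pre \<xi> n \<notin> level_trace n (Fix m K)"] that by (simp add: n_def)
    then have "pre \<xi> (N n) \<in> section_of m N (Fix m K)"
      using n N[of n] \<xi>(1) by (auto simp: section_of_def pre_verts take_pre intro!: exI[of _ n])
    then have "\<xi> \<notin> cyl m (pre \<xi> (N n))" by (rule \<xi>(2))
    then show False using \<xi>(1) by (simp add: cyl_iff)
  qed
next
  fix \<xi> assume \<xi>: "\<xi> \<in> Fix m K"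
  have "\<xi> \<notin> cyl m w" if mem: "w \<in> section_of m N (Fix m K)" for w
  proof
    assume "\<xi> \<in> cyl m w"
    then have w: "pre \<xi> (length w) = w" by (simp add: cyl_iff)
    obtain n where n: "length w = N n" "take n w \<notin> level_trace n (Fix m K)" using mem by (auto simp: section_of_def)
    have "take n w = pre \<xi> n" using w n(1) N[of n] take_pre[of n "N n" \<xi>] by simp
    then show False using n(2) \<xi> by (auto simp: level_trace_def)
  qed
  then show "\<xi> \<in> pi_perp m (section_of m N (Fix m K))" using \<xi> Fix_bd by (auto simp: pi_perp_def)
qed

text \<open>The depth \<open>N n\<close> depends on the level alone, and automorphisms preserve
  levels and carry traces to traces.\<close>

lemma section_of_act:
  assumes g: "g \<in> G" and F: "F \<subseteq> bd m"
  shows "section_of m N (act_bd g ` F) = g ` section_of m N F"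
proof -
  note ga = G_aut[OF g] and b = G_bij[OF g]
  have *: "g u \<in> section_of m N (act_bd g ` F) \<longleftrightarrow> u \<in> section_of m N F" for u
  proof (cases "u \<in> verts m")
    case True
    have "take j (g u) \<in> level_trace j (act_bd g ` F) \<longleftrightarrow> take j u \<in> level_trace j F" for j
      unfolding trace_act[OF g F] aut_take[OF ga True, symmetric]
      using b by (simp add: bij_def inj_image_mem_iff)
    then show ?thesis using True ga by (simp add: section_of_def aut_verts_iff aut_length)
  next
    case False
    then show ?thesis using ga by (simp add: section_of_def aut_verts_iff)
  qed
  show ?thesis
  proof (intro equalityI subsetI)
    fix w assume w: "w \<in> section_of m N (act_bd g ` F)"
    have gw: "g (inv g w) = w" using bij_inv_cancel(2)[OF b] .
    then have "inv g w \<in> section_of m N F" using w *[of "inv g w"] by simp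
    with gw show "w \<in> g ` section_of m N F" by (metis imageI)
  qed (use * in blast)
qed

end

context weakly_branch_URS
begin

text \<open>A property decided by the trace at one level \<open>L\<close> is a union of trace
  classes, which are open.\<close>

lemma openin_Fix_image:
  assumes Q: "\<And>F F'. level_trace L F = level_trace L F' \<Longrightarrow> Q F \<longleftrightarrow> Q F'"
  shows "openin (subtopology (hausdorff_top m) (Fix m ` \<H>)) {F \<in> Fix m ` \<H>. Q F}"
proof -
  let ?\<B> = "{{B \<in> closed_sets m. level_trace L A = level_trace L B} |A. A \<in> Fix m ` \<H> \<and> Q A}"
  have cl: "Fix m ` \<H> \<subseteq> closed_sets m" using Fix_closed URS_subgroup(2) by blast
  have "openin (hausdorff_top m) (\<Union>?\<B>)"
    using openin_hausdorff_trace cl by (intro openin_Union) blast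
  moreover have "{F \<in> Fix m ` \<H>. Q F} = \<Union>?\<B> \<inter> Fix m ` \<H>"
  proof (intro equalityI subsetI)
    fix F assume "F \<in> {F \<in> Fix m ` \<H>. Q F}"
    then show "F \<in> \<Union>?\<B> \<inter> Fix m ` \<H>" using cl by blast
  next
    fix F assume F: "F \<in> \<Union>?\<B> \<inter> Fix m ` \<H>"
    then obtain A where "Q A" "level_trace L A = level_trace L F" by blast
    then show "F \<in> {F \<in> Fix m ` \<H>. Q F}" using F Q by blast
  qed
  ultimately show ?thesis unfolding openin_subtopology by blast
qed

lemma section_of_continuous:
  assumes N: "\<And>n. n \<le> N n"
  shows "continuous_map (subtopology (hausdorff_top m) (Fix m ` \<H>)) (Pi_top m) (section_of m N)"
  unfolding Pi_top_def continuous_on_generated_topo_iff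
proof (intro conjI allI impI)
  let ?Y = "subtopology (hausdorff_top m) (Fix m ` \<H>)"
  let ?S = "section_of m N"
  have top: "topspace ?Y = Fix m ` \<H>"
    using Fix_closed URS_subgroup(2) by (auto simp: topspace_hausdorff)
  note Pi = section_of_Pi[of N, OF N]
  fix U assume "U \<in> {{P \<in> Pi_T m. v \<in> P} |v. v \<in> verts m} \<union> {{P \<in> Pi_T m. v \<notin> P} |v. v \<in> verts m}"
  then obtain v where "U = {P \<in> Pi_T m. v \<in> P} \<or> U = {P \<in> Pi_T m. v \<notin> P}" by blast
  then have "?S -` U \<inter> topspace ?Y = {F \<in> Fix m ` \<H>. v \<in> ?S F} \<or> ?S -` U \<inter> topspace ?Y = {F \<in> Fix m ` \<H>. v \<notin> ?S F}"
    unfolding top using Pi by blast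
  \<comment> \<open>Membership of \<open>v\<close> and its negation are both decided at level
    \<open>length v\<close>.\<close>
  moreover have "openin ?Y {F \<in> Fix m ` \<H>. v \<in> ?S F}"
    using section_of_cong[of N v _ _ m, OF N] by (rule openin_Fix_image)
  moreover have "openin ?Y {F \<in> Fix m ` \<H>. v \<notin> ?S F}"
    by (rule openin_Fix_image[of "length v"]) (use section_of_cong[of N v _ _ m, OF N] in blast)
  ultimately show "openin ?Y (?S -` U \<inter> topspace ?Y)" by auto
next
  have "[] \<in> verts m" by (simp add: verts_def)
  then have "Pi_T m \<subseteq> \<Union>({{P \<in> Pi_T m. v \<in> P} |v. v \<in> verts m} \<union> {{P \<in> Pi_T m. v \<notin> P} |v. v \<in> verts m})"
    by blast
  then show "section_of m N ` topspace (subtopology (hausdorff_top m) (Fix m ` \<H>))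
      \<subseteq> \<Union>({{P \<in> Pi_T m. v \<in> P} |v. v \<in> verts m} \<union> {{P \<in> Pi_T m. v \<notin> P} |v. v \<in> verts m})"
    by (rule subset_trans[rotated]) (intro image_subsetI section_of_Pi N)
qed

lemma exists_section:
  "\<exists>\<sigma>. continuous_map (subtopology (hausdorff_top m) (Fix m ` \<H>)) (Pi_top m) \<sigma>
          \<and> (\<forall>g\<in>G. \<forall>F\<in>Fix m ` \<H>. \<sigma> (act_bd g ` F) = g ` \<sigma> F)
          \<and> (\<forall>F\<in>Fix m ` \<H>. pi_perp m (\<sigma> F) = F)
          \<and> (\<forall>H\<in>\<H>. \<forall>v\<in>\<sigma> (Fix m H). derived (rist m G v) \<subseteq> H)"
proof -
  \<comment> \<open>The depth \<open>N n\<close> is uniform over \<open>\<H>\<close>, so the section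
    depends on \<open>H\<close> only through \<open>Fix m H\<close>.\<close>
  obtain N where N: "\<And>n. n \<le> N n"
    "\<And>n K w. K \<in> \<H> \<Longrightarrow> w \<in> lev m (N n) \<Longrightarrow> take n w \<in> level_trace n (Fix m K) \<or> has_comms m G K w"
    using uniform_level by metis
  have "derived (rist m G v) \<subseteq> H" if H: "H \<in> \<H>" and v: "v \<in> section_of m N (Fix m H)" for H v
  proof -
    obtain n where "v \<in> lev m (N n)" "take n v \<notin> level_trace n (Fix m H)"
      using v by (auto simp: section_of_def lev_def)
    then show ?thesis using N(2)[OF H] has_comms_iff[OF URS_subgroup(1)[OF H]] by blast
  qed
  then show ?thesis
    using section_of_continuous[OF N(1)] section_of_act[OF _ Fix_bd] pi_perp_section_of[OF N(1) URS_subgroup(2)]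
    by (intro exI[of _ "section_of m N"]) auto
qed

end

theorem theorem5p17:
  fixes m :: "nat \<Rightarrow> nat" and G :: "autom set" and \<H> :: "autom set set"
  assumes "weakly_branch m G"
    and "is_URS G \<H>"
  shows "continuous_map (subtopology (chabauty G) \<H>) (hausdorff_top m) (Fix m)
       \<and> (\<exists>\<sigma>. continuous_map (subtopology (hausdorff_top m) (Fix m ` \<H>)) (Pi_top m) \<sigma>
          \<and> (\<forall>g\<in>G. \<forall>F\<in>Fix m ` \<H>. \<sigma> (act_bd g ` F) = g ` \<sigma> F)
          \<and> (\<forall>F\<in>Fix m ` \<H>. pi_perp m (\<sigma> F) = F)
          \<and> (\<forall>H\<in>\<H>. \<forall>v\<in>\<sigma> (Fix m H). derived (rist m G v) \<subseteq> H))"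
proof -
  interpret weakly_branch_URS m G \<H>
    using assms by unfold_locales
  show ?thesis using Fix_continuous exists_section by blast
qed

end
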